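(* Assume the standing setting and assumptions (A1)–(A4) described in the context. There exists an LP MFG Nash equilibrium, i.e. there exists $(\mu^\star,m^\star)\in\mathcal R$ such that for all $(\mu,m)\in\mathcal R$, $$\Gamma[\mu^\star,m^\star](\mu,m)\le\Gamma[\mu^\star,m^\star](\mu^\star,m^\star).$$
   Context: Setting. $T\in\mathbb N^*$, $I=\{0,\dots,T\}$, $I^*=\{1,\dots,T\}$. $(E,d)$ is a nonempty compact metric space, $D\subset E$ a nonempty compact set, $H=\{z_j: j\in\mathcal I\}$ a nonempty finite set with distinct elements, $\mathcal I=\{1,\dots,|H|\}$. $(\Omega,\mathcal F,\mathbb F,\mathbb P)$ is a complete filtered probability space carrying $\mathbb F$-adapted processes $X=(X_t)_{t\in I}$ with values in $E$ and $Z=(Z_t)_{t\in I}$ (common noise) with values in $H$. The process $U$ takes values in $W:=\{0,1\}^{(T+1)\times|H|}$ (matrices with entries $0$ or $1$): $U_t(s+1,j)=\mathbf 1_{s\le t}\mathbf 1_{Z_s=z_j}$ for $(s,j)\in I\times\mathcal I$, $t\in I$. Finite sets carry the discrete topology. $\Omega_t:=\{u\in W:\mathbb P(U_t=u)>0\}$, $p_t(u):=\mathbb P(U_t=u)$, and $m_0^*(u)(B):=\mathbb P(X_0\in B\mid U_0=u)$ for $u\in\Omega_0$. Assumptions. (A1) $X_0\in D$ a.s. (A2) $(X,U)$ is an $\mathbb F$-Markov chain with transition kernels $(\pi_t)_{t\in I^*}$ on $E\times W$ (i.e. $\pi_t(X_{t-1},U_{t-1};\cdot)$ is the conditional law of $(X_t,U_t)$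 given $\mathcal F_{t-1}$) such that $\pi_t(x,u;E\times\{u'\})=\pi_t(\bar x,u;E\times\{u'\})$ for all $t\in I^*$, $x,\bar x\in E$, $u,u'\in W$. (A3) For each $t\in I^*$, $\pi_t:E\times W\to\mathcal P(E\times W)$ is continuous (weak convergence on the target). (A4) For each $t$, the reward functions $f_t:D\times W\times\mathcal P^{sub}(D)\to\mathbb R$ ($t\in I\setminus\{T\}$) and $g_t:E\times W\times\mathcal P^{sub}(E)\to\mathbb R$ ($t\in I$) are continuous. Here $\mathcal P^{sub}(K)$ is the set of Borel subprobability measures on $K$ with the topology of weak convergence; product spaces carry product topologies. Operator: for $\varphi\in C(I\times E\times W)$, $t\in I\setminus\{T\}$, $$\mathcal L(\varphi)(t,x,u):=\int_{E\times W}[\varphi(t+1,x',u')-\varphi(t,x,u)]\,\pi_{t+1}(x,u;dx',du').$$ Constraint set: $\mathcal R$ is the set of pairs $(\mu,m)\in\mathcal C_\mu\times\mathcal C_m$, $\mathcal C_\mu:=\prod_{t\in I}\mathcal P^{sub}(E)^{\Omega_t}$, $\mathcal C_m:=\prod_{t\in I\setminus\{T\}}\mathcal P^{sub}(D)^{\Omega_t}$ ($\mathcal Y^{\mathcal X}$ denotes functions from $\mathcal X$ to $\mathcal Y$), such that for all $\varphi\in C(I\times E\times W)$, $$\sum_{t=0}^T\sum_{u\in\Omega_t}p_t(u)\int_E\varphi(t,x,u)\mu_t(u)(dx)=\sum_{u\in\Omega_0}p_0(u)\int_D\varphi(0,x,u)m_0^*(u)(dx)+\sum_{t=0}^{T-1}\sum_{u\in\Omega_t}p_t(u)\int_D\mathcal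 L(\varphi)(t,x,u)m_t(u)(dx).$$ Reward functional: for $(\bar\mu,\bar m)\in\mathcal R$ and $(\mu,m)\in\mathcal R$, $$\Gamma[\bar\mu,\bar m](\mu,m)=\sum_{t=0}^{T-1}\sum_{u\in\Omega_t}p_t(u)\int_Df_t(x,u,\bar m_t(u))\,m_t(u)(dx)+\sum_{t=0}^T\sum_{u\in\Omega_t}p_t(u)\int_Eg_t(x,u,\bar\mu_t(u))\,\mu_t(u)(dx).$$ *)

theory Defs
  imports "HOL-Probability.Probability"
begin

section \<open>Weak convergence of measures\<close>

text \<open>
  For a topological space \<open>S\<close> and a set \<open>P\<close> of finite Borel measures on it: the coarsest topology on
  \<open>P\<close> for which \<open>\<nu> \<mapsto> \<integral> h d\<nu>\<close> is continuous for every bounded continuous \<open>h\<close> on \<open>S\<close>. The whole set \<open>P\<close>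
  is one of the generators (\<open>V = UNIV\<close>), so \<open>P\<close> is the carrier of this topology.
\<close>

definition weak_topology :: "'a topology \<Rightarrow> 'a measure set \<Rightarrow> 'a measure topology" where
  "weak_topology S P = topology_generated_by
     {{\<nu> \<in> P. (\<integral>x. h x \<partial>\<nu>) \<in> V} | h (V :: real set).
        continuous_map S euclideanreal h \<and> bounded (h ` topspace S) \<and> open V}"

definition borel_on :: "'a::topological_space set \<Rightarrow> 'a measure" where
  "borel_on K = restrict_space borel K"

definition subprobs_on :: "'a::topological_space set \<Rightarrow> 'a measure set" where
  "subprobs_on K = space (subprob_algebra (borel_on K))"

definition subprobs_top :: "'a::topological_space set \<Rightarrow> 'a measure topology" where
  "subprobs_top K = weak_topology (top_of_set K) (subprobs_on K)"


section \<open>The common-noise matrices and the state space\<close>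

text \<open>
  Matrices in \<open>{0,1}\<^bsup>(T+1)\<times>N\<^esup>\<close> are functions of the 1-based (row, column) pair, \<open>undefined\<close> outside
  the index range.
\<close>

type_synonym mat01 = "nat \<times> nat \<Rightarrow> nat"

definition matrices01 :: "nat \<Rightarrow> nat \<Rightarrow> mat01 set" where
  "matrices01 T N = ({1..T + 1} \<times> {1..N}) \<rightarrow>\<^sub>E {0, 1}"

text \<open>Row \<open>i = s + 1\<close> records the noise at time \<open>s = i - 1\<close>.\<close>

definition noise_matrix ::
  "nat \<Rightarrow> nat \<Rightarrow> (nat \<Rightarrow> 'z) \<Rightarrow> (nat \<Rightarrow> 'w \<Rightarrow> 'z) \<Rightarrow> nat \<Rightarrow> 'w \<Rightarrow> mat01" where
  "noise_matrix T N z Z t \<omega> = (\<lambda>(i, j) \<in> {1..T + 1} \<times> {1..N}.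
     if i - 1 \<le> t \<and> Z (i - 1) \<omega> = z j then 1 else 0)"

definition state_measure :: "'e::metric_space set \<Rightarrow> mat01 set \<Rightarrow> ('e \<times> mat01) measure" where
  "state_measure E W = borel_on E \<Otimes>\<^sub>M count_space W"

definition state_top :: "'e::metric_space set \<Rightarrow> mat01 set \<Rightarrow> ('e \<times> mat01) topology" where
  "state_top E W = prod_topology (top_of_set E) (discrete_topology W)"

definition state_probs_top ::
  "'e::metric_space set \<Rightarrow> mat01 set \<Rightarrow> ('e \<times> mat01) measure topology" where
  "state_probs_top E W =
     weak_topology (state_top E W) (space (prob_algebra (state_measure E W)))"


section \<open>The filtered probability space and the Markov property\<close>

definition complete_filtered_prob_space ::
  "'w measure \<Rightarrow> nat \<Rightarrow> (nat \<Rightarrow> 'w measure) \<Rightarrow> bool" where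
  "complete_filtered_prob_space M T F \<longleftrightarrow>
     prob_space M \<and> complete_measure M \<and>
     (\<forall>t\<in>{0..T}. subalgebra M (F t) \<and> null_sets M \<subseteq> sets (F t)) \<and>
     (\<forall>s t. s \<le> t \<and> t \<le> T \<longrightarrow> sets (F s) \<subseteq> sets (F t))"

text \<open>
  \<open>prob_algebra\<close>-measurability says that \<open>\<pi>\<^sub>t\<close> is a probability kernel; the second conjunct says that
  \<open>\<pi>\<^sub>t(Y\<^sub>t\<^sub>-\<^sub>1; \<cdot>)\<close> is the conditional law of \<open>Y\<^sub>t\<close> given \<open>F\<^sub>t\<^sub>-\<^sub>1\<close>.
\<close>

definition markov_chain_with_kernels ::
  "'w measure \<Rightarrow> nat \<Rightarrow> (nat \<Rightarrow> 'w measure) \<Rightarrow> 's measure \<Rightarrow>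
   (nat \<Rightarrow> 'w \<Rightarrow> 's) \<Rightarrow> (nat \<Rightarrow> 's \<Rightarrow> 's measure) \<Rightarrow> bool" where
  "markov_chain_with_kernels M T F S Y \<pi> \<longleftrightarrow>
     (\<forall>t\<in>{0..T}. Y t \<in> F t \<rightarrow>\<^sub>M S) \<and>
     (\<forall>t\<in>{1..T}. \<pi> t \<in> S \<rightarrow>\<^sub>M prob_algebra S \<and>
        (\<forall>B\<in>sets S. AE \<omega> in M.
           real_cond_exp M (F (t - 1)) (\<lambda>\<omega>'. indicator B (Y t \<omega>')) \<omega>
             = measure (\<pi> t (Y (t - 1) \<omega>)) B))"


section \<open>The linear programming formulation\<close>

definition hist_prob :: "'w measure \<Rightarrow> (nat \<Rightarrow> 'w \<Rightarrow> mat01) \<Rightarrow> nat \<Rightarrow> mat01 \<Rightarrow> real" where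
  "hist_prob M U t u = measure M {\<omega> \<in> space M. U t \<omega> = u}"

definition hist_supp ::
  "'w measure \<Rightarrow> mat01 set \<Rightarrow> (nat \<Rightarrow> 'w \<Rightarrow> mat01) \<Rightarrow> nat \<Rightarrow> mat01 set" where
  "hist_supp M W U t = {u \<in> W. hist_prob M U t u > 0}"

text \<open>The conditional law \<open>m\<^sub>0\<^sup>*(u)(B) = P(X\<^sub>0 \<in> B | U\<^sub>0 = u)\<close>, as a measure on \<open>E\<close>.\<close>

definition initial_law ::
  "'w measure \<Rightarrow> 'e::metric_space set \<Rightarrow> (nat \<Rightarrow> 'w \<Rightarrow> 'e) \<Rightarrow> (nat \<Rightarrow> 'w \<Rightarrow> mat01)
   \<Rightarrow> mat01 \<Rightarrow> 'e measure" where
  "initial_law M E X U u =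
     distr (uniform_measure M {\<omega> \<in> space M. U 0 \<omega> = u}) (borel_on E) (X 0)"

definition test_functions ::
  "nat \<Rightarrow> 'e::metric_space set \<Rightarrow> mat01 set \<Rightarrow> (nat \<times> 'e \<times> mat01 \<Rightarrow> real) set" where
  "test_functions T E W =
     {\<phi>. continuous_map (prod_topology (discrete_topology {0..T}) (state_top E W)) euclideanreal \<phi>}"

definition generator ::
  "(nat \<Rightarrow> 'e \<times> mat01 \<Rightarrow> ('e \<times> mat01) measure) \<Rightarrow> (nat \<times> 'e \<times> mat01 \<Rightarrow> real)
   \<Rightarrow> nat \<times> 'e \<times> mat01 \<Rightarrow> real" where
  "generator \<pi> \<phi> = (\<lambda>(t, x, u).
     \<integral>(x', u'). (\<phi> (t + 1, x', u') - \<phi> (t, x, u)) \<partial>\<pi> (t + 1) (x, u))"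

type_synonym 'e measure_flow = "nat \<Rightarrow> mat01 \<Rightarrow> 'e measure"

text \<open>
  The measures \<open>\<mu> t u\<close> and \<open>m t u\<close> live on \<open>E\<close> and \<open>D\<close> respectively, so their plain integrals are
  integrals over \<open>E\<close> and \<open>D\<close>; only the initial law, a measure on \<open>E\<close>, is explicitly integrated over \<open>D\<close>.
\<close>

definition LP_constraint_set ::
  "'w measure \<Rightarrow> nat \<Rightarrow> 'e::metric_space set \<Rightarrow> 'e set \<Rightarrow> mat01 set \<Rightarrow>
   (nat \<Rightarrow> 'w \<Rightarrow> 'e) \<Rightarrow> (nat \<Rightarrow> 'w \<Rightarrow> mat01) \<Rightarrow>
   (nat \<Rightarrow> 'e \<times> mat01 \<Rightarrow> ('e \<times> mat01) measure) \<Rightarrow>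
   ('e measure_flow \<times> 'e measure_flow) set" where
  "LP_constraint_set M T E D W X U \<pi> =
     {(\<mu>, m).
        \<mu> \<in> (\<Pi>\<^sub>E t\<in>{0..T}. hist_supp M W U t \<rightarrow>\<^sub>E subprobs_on E) \<and>
        m \<in> (\<Pi>\<^sub>E t\<in>{0..<T}. hist_supp M W U t \<rightarrow>\<^sub>E subprobs_on D) \<and>
        (\<forall>\<phi> \<in> test_functions T E W.
           (\<Sum>t\<in>{0..T}. \<Sum>u\<in>hist_supp M W U t.
              hist_prob M U t u * (\<integral>x. \<phi> (t, x, u) \<partial>\<mu> t u))
         = (\<Sum>u\<in>hist_supp M W U 0.
              hist_prob M U 0 u * (LINT x:D|initial_law M E X U u. \<phi> (0, x, u)))
         + (\<Sum>t\<in>{0..<T}. \<Sum>u\<in>hist_supp M W U t.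
              hist_prob M U t u * (\<integral>x. generator \<pi> \<phi> (t, x, u) \<partial>m t u)))}"

definition reward ::
  "'w measure \<Rightarrow> nat \<Rightarrow> mat01 set \<Rightarrow> (nat \<Rightarrow> 'w \<Rightarrow> mat01) \<Rightarrow>
   (nat \<Rightarrow> 'e \<times> mat01 \<times> 'e measure \<Rightarrow> real) \<Rightarrow> (nat \<Rightarrow> 'e \<times> mat01 \<times> 'e measure \<Rightarrow> real) \<Rightarrow>
   'e measure_flow \<times> 'e measure_flow \<Rightarrow> 'e measure_flow \<times> 'e measure_flow \<Rightarrow> real" where
  "reward M T W U f g = (\<lambda>(\<mu>bar, mbar) (\<mu>, m).
     (\<Sum>t\<in>{0..<T}. \<Sum>u\<in>hist_supp M W U t.
        hist_prob M U t u * (\<integral>x. f t (x, u, mbar t u) \<partial>m t u))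
   + (\<Sum>t\<in>{0..T}. \<Sum>u\<in>hist_supp M W U t.
        hist_prob M U t u * (\<integral>x. g t (x, u, \<mu>bar t u) \<partial>\<mu> t u)))"

end

theory Submission
  imports Defs
begin

text \<open>
  The theorem is a Nash equilibrium existence result for a game whose
  payoff is affine in the deviation: \<open>\<Gamma>[s](s')\<close> is jointly continuous in \<open>(s, s')\<close> and affine in \<open>s'\<close>, and the
  admissible pairs form a nonempty compact convex set \<open>R\<close>. In this situation the sets
  \<open>{s. \<Gamma>[s](y) \<le> \<Gamma>[s](s)}\<close>, \<open>y \<in> R\<close>, are closed, so by compactness it suffices that finitely many of them
  meet. For \<open>y\<^sub>1, \<dots>, y\<^sub>n\<close> one only mixes these points: the Nash map on the simplex of weights has a fixed
  point by Brouwer's theorem, and at the corresponding mixture no \<open>y\<^sub>i\<close> is a profitable deviation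
  (\<open>equilibrium_of_mixtures\<close>). The dimension \<open>n\<close> ranges over all finite sets of deviations, so
  Brouwer's theorem is derived for a cube whose coordinates are natural numbers, from Kuhn's
  combinatorial lemma (\<open>brouwer_unit_cube\<close>).

  The other main point is compactness of \<open>R\<close>, which reduces by Tychonoff's theorem to compactness of
  the subprobabilities on a compact metric space (\<open>compact_space_subprobs_top\<close>). They are exhibited as
  a continuous image of the set of finitely additive set functions with values in \<open>[0, 1]\<close>; that set is
  closed in a power of \<open>[0, 1]\<close>, hence compact. The image of a finitely additive \<open>a\<close> is the law of a
  random point: the space is cut by countably many open sets into a binary tree of cells of shrinking
  diameter, the cells of each level are laid out on \<open>[0, a K)\<close> as consecutive intervals of length \<open>a\<close>,
  and a real number in that interval selects a nested sequence of cells, which converges to a point.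

  The set \<open>R\<close> is closed because the generator maps continuous functions to continuous functions
  (the kernels are weakly continuous), so that both sides of each constraint are continuous in the
  measures; it is convex because they are affine; and it contains the strategy of stopping
  immediately, for which \<open>m = 0\<close>, \<open>\<mu>\<^sub>0\<close> is the initial law and all other \<open>\<mu>\<^sub>t\<close> vanish.
\<close>

section \<open>Brouwer's theorem on a cube of arbitrary dimension\<close>

lemma tendsto_fun_componentwise:
  fixes f :: "'a \<Rightarrow> 'b \<Rightarrow> 'c::topological_space"
  shows "(f \<longlongrightarrow> l) F \<longleftrightarrow> (\<forall>i. ((\<lambda>x. f x i) \<longlongrightarrow> l i) F)"
  using limitin_componentwise[of "\<lambda>_. euclidean" UNIV f l F]
  by (simp add: euclidean_product_topology)

text \<open>
  Points of the \<open>n\<close>-cube are sequences that vanish from index \<open>n\<close> on, so that \<open>n\<close> is an ordinary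
  variable and not a type.
\<close>

definition unit_cube :: "nat \<Rightarrow> (nat \<Rightarrow> real) set" where
  "unit_cube n = {x. (\<forall>i<n. x i \<in> {0..1}) \<and> (\<forall>i\<ge>n. x i = 0)}"

lemma compact_unit_cube: "compact (unit_cube n)"
proof -
  have "unit_cube n = PiE UNIV (\<lambda>i. if i < n then {0..1} else {0})"
    by (rule set_eqI, simp add: unit_cube_def PiE_UNIV_domain Pi_iff, metis linorder_not_less)
  moreover have "compactin (product_topology (\<lambda>i. euclideanreal) UNIV)
      (PiE UNIV (\<lambda>i. if i < n then {0..1} else {0}))"
    unfolding compactin_PiE by auto
  ultimately show ?thesis
    by (simp add: euclidean_product_topology)
qed

text \<open>
  Subdivide the cube into small cubes of side \<open>1/p\<close> and label coordinate \<open>i\<close> of a grid point by the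
  direction in which \<open>\<Phi>\<close> moves it. Kuhn's lemma gives a small cube on whose corners every coordinate
  receives both labels. As \<open>p\<close> grows, a subsequence of these cubes shrinks to a point, and there the
  inequalities of both directions survive, so \<open>\<Phi>\<close> moves no coordinate.
\<close>

lemma brouwer_unit_cube:
  fixes \<Phi> :: "(nat \<Rightarrow> real) \<Rightarrow> nat \<Rightarrow> real"
  assumes cont: "\<And>i. i < n \<Longrightarrow> continuous_on (unit_cube n) (\<lambda>x. \<Phi> x i)"
    and range: "\<And>x i. x \<in> unit_cube n \<Longrightarrow> i < n \<Longrightarrow> \<Phi> x i \<in> {0..1}"
  obtains x where "x \<in> unit_cube n" "\<And>i. i < n \<Longrightarrow> \<Phi> x i = x i"
proof -
  define grid :: "nat \<Rightarrow> (nat \<Rightarrow> nat) \<Rightarrow> nat \<Rightarrow> real" where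
    "grid p a = (\<lambda>i. if i < n then real (a i) / real p else 0)" for p a
  \<comment> \<open>Label 0 on the face \<open>a i = 0\<close> and 1 on the face \<open>a i = p\<close>, as Kuhn's lemma demands; both are compatible with \<open>range\<close>.\<close>
  define label where
    "label p a i = (if a i = 0 \<or> (a i \<noteq> p \<and> grid p a i \<le> \<Phi> (grid p a) i) then 0 else 1::nat)"
    for p a i
  have grid_cube: "grid p a \<in> unit_cube n" if "\<forall>i<n. a i \<le> p" for p a
    using that by (auto simp: grid_def unit_cube_def divide_le_eq_1 intro: divide_nonneg_nonneg)
  have label_0: "grid p a i \<le> \<Phi> (grid p a) i"
    if "\<forall>i<n. a i \<le> p" "i < n" "label p a i = 0" for p a i
    using that range[OF grid_cube[OF that(1)] that(2)]
    by (auto simp: label_def grid_def split: if_splits)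
  have label_1: "\<Phi> (grid p a) i \<le> grid p a i"
    if "\<forall>i<n. a i \<le> p" "i < n" "label p a i \<noteq> 0" for p a i
    using that range[OF grid_cube[OF that(1)] that(2)]
    by (auto simp: label_def grid_def split: if_splits)
  define cell where "cell q a \<longleftrightarrow> (\<forall>j<n. q j \<le> a j \<and> a j \<le> q j + 1)" for q a :: "nat \<Rightarrow> nat"
  have "\<exists>q. (\<forall>i<n. q i < Suc p) \<and> (\<forall>i<n. \<exists>r s. cell q r \<and> cell q s \<and>
      label (Suc p) r i = 0 \<and> label (Suc p) s i \<noteq> 0)" for p
  proof -
    have "\<forall>x. (\<forall>i<n. x i \<le> Suc p) \<longrightarrow> (\<forall>i<n. label (Suc p) x i = 0 \<or> label (Suc p) x i = 1)"
      "\<forall>x. (\<forall>i<n. x i \<le> Suc p) \<longrightarrow> (\<forall>i<n. x i = 0 \<longrightarrow> label (Suc p) x i = 0)"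
      "\<forall>x. (\<forall>i<n. x i \<le> Suc p) \<longrightarrow> (\<forall>i<n. x i = Suc p \<longrightarrow> label (Suc p) x i = 1)"
      by (simp_all add: label_def)
    from kuhn_lemma[of "Suc p" n "label (Suc p)", OF zero_less_Suc this]
    obtain q where q: "\<forall>i<n. q i < Suc p" and rs: "\<forall>i<n. \<exists>r s. (\<forall>j<n. q j \<le> r j \<and> r j \<le> q j + 1) \<and>
      (\<forall>j<n. q j \<le> s j \<and> s j \<le> q j + 1) \<and> label (Suc p) r i \<noteq> label (Suc p) s i" .
    have "\<exists>r s. cell q r \<and> cell q s \<and> label (Suc p) r i = 0 \<and> label (Suc p) s i \<noteq> 0"
      if i: "i < n" for i
    proof -
      obtain r s where rs: "cell q r" "cell q s" "label (Suc p) r i \<noteq> label (Suc p) s i"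
        using rs[rule_format, OF i] unfolding cell_def by blast
      have "label (Suc p) a i = 0 \<or> label (Suc p) a i = 1" for a
        by (simp add: label_def)
      with rs(3) have "label (Suc p) r i = 0 \<and> label (Suc p) s i \<noteq> 0 \<or>
          label (Suc p) s i = 0 \<and> label (Suc p) r i \<noteq> 0"
        by (metis zero_neq_one)
      with rs(1,2) show ?thesis by blast
    qed
    then show ?thesis using q by (intro exI[of _ q]) simp
  qed
  then have "\<forall>p. \<exists>q. (\<forall>i<n. q i < Suc p) \<and> (\<forall>i<n. \<exists>r s. cell q r \<and> cell q s \<and>
      label (Suc p) r i = 0 \<and> label (Suc p) s i \<noteq> 0)" ..
  from choice[OF this] obtain q where q: "\<And>p i. i < n \<Longrightarrow> q p i < Suc p"
    and q': "\<And>p i. i < n \<Longrightarrow> \<exists>r s. cell (q p) r \<and> cell (q p) s \<and>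
      label (Suc p) r i = 0 \<and> label (Suc p) s i \<noteq> 0"
    by blast
  have "\<forall>p i. \<exists>r s. i < n \<longrightarrow> cell (q p) r \<and> cell (q p) s \<and>
      label (Suc p) r i = 0 \<and> label (Suc p) s i \<noteq> 0"
    using q' by blast
  then obtain r s where rs: "\<And>p i. i < n \<Longrightarrow> cell (q p) (r p i) \<and> cell (q p) (s p i) \<and>
      label (Suc p) (r p i) i = 0 \<and> label (Suc p) (s p i) i \<noteq> 0"
    unfolding choice_iff by blast
  have "\<forall>p. grid (Suc p) (q p) \<in> unit_cube n"
    by (intro allI grid_cube) (use q less_imp_le in blast)
  then obtain l \<rho> where l: "l \<in> unit_cube n" and \<rho>: "strict_mono \<rho>"
    and lim: "((\<lambda>p. grid (Suc p) (q p)) \<circ> \<rho>) \<longlonglongrightarrow> l"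
    by (rule seq_compactE[OF compact_imp_seq_compact[OF compact_unit_cube]])
  \<comment> \<open>The corners of the small cubes converge to the same limit.\<close>
  have near: "(\<lambda>k. grid (Suc (\<rho> k)) (a (\<rho> k))) \<longlonglongrightarrow> l"
    if a: "\<And>p. cell (q p) (a p)" for a
    unfolding tendsto_fun_componentwise
  proof
    fix j
    have lim_j: "(\<lambda>k. grid (Suc (\<rho> k)) (q (\<rho> k)) j) \<longlonglongrightarrow> l j"
      using lim unfolding tendsto_fun_componentwise by (simp add: comp_def)
    have "\<bar>grid (Suc p) (a p) j - grid (Suc p) (q p) j\<bar> \<le> inverse (real (Suc p))" for p
    proof (cases "j < n")
      case True
      have "grid (Suc p) (a p) j - grid (Suc p) (q p) j = (real (a p j) - real (q p j)) / real (Suc p)"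
        using True by (simp add: grid_def diff_divide_distrib)
      moreover have "q p j \<le> a p j" "a p j \<le> q p j + 1"
        using a[of p, unfolded cell_def, rule_format, OF True] by blast+
      then have "0 \<le> real (a p j) - real (q p j)" "real (a p j) - real (q p j) \<le> 1"
        by simp_all
      ultimately show ?thesis
        by (simp add: inverse_eq_divide divide_right_mono)
    qed (simp add: grid_def)
    then have bound: "norm (grid (Suc (\<rho> k)) (a (\<rho> k)) j - grid (Suc (\<rho> k)) (q (\<rho> k)) j)
        \<le> inverse (real (Suc (\<rho> k)))" for k
      by (simp del: of_nat_Suc)
    have "(\<lambda>k. inverse (real (Suc (\<rho> k)))) \<longlonglongrightarrow> 0"
      using LIMSEQ_subseq_LIMSEQ[OF LIMSEQ_inverse_real_of_nat \<rho>] by (simp add: comp_def)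
    from Lim_null_comparison[OF always_eventually[OF allI[OF bound]] this]
    have "(\<lambda>k. grid (Suc (\<rho> k)) (a (\<rho> k)) j - grid (Suc (\<rho> k)) (q (\<rho> k)) j) \<longlonglongrightarrow> 0" .
    from tendsto_add[OF this lim_j] show "(\<lambda>k. grid (Suc (\<rho> k)) (a (\<rho> k)) j) \<longlonglongrightarrow> l j"
      by simp
  qed
  have le_p: "\<forall>j<n. a p j \<le> Suc p"
    if "\<And>p. cell (q p) (a p)" for a p
  proof (intro allI impI)
    fix j assume "j < n"
    have "a p j \<le> q p j + 1" using that[of p] \<open>j < n\<close> by (simp add: cell_def)
    with q[OF \<open>j < n\<close>, of p] show "a p j \<le> Suc p" by simp
  qed
  have "\<Phi> l i = l i" if i: "i < n" for i
  proof (rule antisym)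
    have lim_\<Phi>: "(\<lambda>k. \<Phi> (grid (Suc (\<rho> k)) (a (\<rho> k))) i) \<longlonglongrightarrow> \<Phi> l i"
      if a: "\<And>p. cell (q p) (a p)" for a
      using grid_cube[OF le_p[OF a]]
      by (intro continuous_on_tendsto_compose[OF cont[OF i] near[OF a] l] always_eventually allI)
    have lim_i: "(\<lambda>k. grid (Suc (\<rho> k)) (a (\<rho> k)) i) \<longlonglongrightarrow> l i"
      if a: "\<And>p. cell (q p) (a p)" for a
      by (rule near[OF a, unfolded tendsto_fun_componentwise, rule_format])
    have r: "\<And>p. cell (q p) (r p i)" and s: "\<And>p. cell (q p) (s p i)"
      using rs[OF i] by blast+
    have "\<Phi> (grid (Suc p) (s p i)) i \<le> grid (Suc p) (s p i) i" for p
      using label_1[OF le_p[of "\<lambda>p. s p i", OF s] i] rs[OF i] by blast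
    then show "\<Phi> l i \<le> l i"
      using LIMSEQ_le[OF lim_\<Phi>[of "\<lambda>p. s p i", OF s] lim_i[of "\<lambda>p. s p i", OF s]] by blast
    have "grid (Suc p) (r p i) i \<le> \<Phi> (grid (Suc p) (r p i)) i" for p
      using label_0[OF le_p[of "\<lambda>p. r p i", OF r] i] rs[OF i] by blast
    then show "l i \<le> \<Phi> l i"
      using LIMSEQ_le[OF lim_i[of "\<lambda>p. r p i", OF r] lim_\<Phi>[of "\<lambda>p. r p i", OF r]] by blast
  qed
  with l show ?thesis by (rule that)
qed

section \<open>Equilibria of games with mixtures\<close>

definition prob_simplex :: "nat \<Rightarrow> (nat \<Rightarrow> real) set" where
  "prob_simplex n = {x. (\<forall>i. 0 \<le> x i) \<and> (\<forall>i\<ge>n. x i = 0) \<and> (\<Sum>i<n. x i) = 1}"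

text \<open>
  A retraction of the cube onto the simplex: a deficit of the coordinate sum is distributed equally,
  an excess is removed by scaling. At most one of the two corrections is active.
\<close>

definition simplex_retraction :: "nat \<Rightarrow> (nat \<Rightarrow> real) \<Rightarrow> nat \<Rightarrow> real" where
  "simplex_retraction n x = (\<lambda>i. if i < n
     then (x i + max 0 (1 - (\<Sum>j<n. x j)) / real n) / max 1 (\<Sum>j<n. x j) else 0)"

lemma simplex_retraction_in_prob_simplex:
  assumes "x \<in> unit_cube n" "n > 0"
  shows "simplex_retraction n x \<in> prob_simplex n"
proof -
  define S where "S = (\<Sum>j<n. x j)"
  have "(\<Sum>i<n. simplex_retraction n x i) = (S + max 0 (1 - S)) / max 1 S"
    using assms(2)
    by (simp add: simplex_retraction_def sum.distrib S_def flip: sum_divide_distrib)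
  also have "\<dots> = 1" by (auto simp: max_def)
  finally show ?thesis
    using assms by (auto simp: prob_simplex_def simplex_retraction_def unit_cube_def)
qed

lemma simplex_retraction_fixes:
  "x \<in> prob_simplex n \<Longrightarrow> simplex_retraction n x = x"
  by (rule ext) (auto simp: prob_simplex_def simplex_retraction_def)

lemma continuous_on_simplex_retraction:
  assumes "n > 0"
  shows "continuous_on A (simplex_retraction n)"
proof (rule continuous_on_coordinatewise_then_product)
  fix i
  show "continuous_on A (\<lambda>x. simplex_retraction n x i)"
    unfolding simplex_retraction_def
    by (cases "i < n")
      (use assms in \<open>auto intro!: continuous_intros
         intro: continuous_on_subset[OF continuous_on_product_coordinates]\<close>)
qed

text \<open>
  With payoffs \<open>a x i\<close> of the pure options, the Nash map raises the weight of each option in proportion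
  to its gain over the average and renormalises. At a fixed point \<open>x\<close> the gains are proportional to the
  weights. If some gain were positive, the options with positive weight would be exactly those that
  beat the average, which contradicts that the weighted deviations from the average sum to zero.
\<close>

lemma finite_equilibrium:
  fixes a :: "(nat \<Rightarrow> real) \<Rightarrow> nat \<Rightarrow> real"
  assumes n: "n > 0"
    and cont: "\<And>i. i < n \<Longrightarrow> continuous_on (prob_simplex n) (\<lambda>x. a x i)"
  obtains x where "x \<in> prob_simplex n" "\<And>i. i < n \<Longrightarrow> a x i \<le> (\<Sum>j<n. x j * a x j)"
proof -
  define avg where "avg x = (\<Sum>j<n. x j * a x j)" for x
  define gain where "gain x i = max 0 (a x i - avg x)" for x i
  define nash where "nash x i = (x i + gain x i) / (1 + (\<Sum>j<n. gain x j))" for x i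
  have gain_nonneg: "0 \<le> gain x i" for x i by (simp add: gain_def)
  then have G_nonneg: "0 \<le> (\<Sum>j<n. gain x j)" for x by (simp add: sum_nonneg)
  have coord: "continuous_on A (\<lambda>x. x i)" for A :: "(nat \<Rightarrow> real) set" and i
    by (rule continuous_on_subset[OF continuous_on_product_coordinates]) auto
  have cont_gain: "continuous_on (prob_simplex n) (\<lambda>x. gain x i)" if "i < n" for i
    unfolding gain_def avg_def using that by (auto intro!: continuous_intros cont coord)
  have cont_nash: "continuous_on (prob_simplex n) (\<lambda>x. nash x i)" if "i < n" for i
    unfolding nash_def using that G_nonneg
    by (auto intro!: continuous_intros cont_gain coord)
      (metis add.commute add_cancel_right_right add_nonneg_eq_0_iff zero_le_one zero_neq_one)
  have nash_sum: "(\<Sum>i<n. nash x i) = 1" if "x \<in> prob_simplex n" for x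
    using that G_nonneg[of x]
    by (simp add: nash_def prob_simplex_def sum.distrib flip: sum_divide_distrib)
  have nash_nonneg: "0 \<le> nash x i" if "x \<in> prob_simplex n" for x i
    using that G_nonneg[of x] gain_nonneg[of x i] by (simp add: nash_def prob_simplex_def)
  \<comment> \<open>The retraction turns the Nash map of the simplex into a self-map of the cube with the same fixed points.\<close>
  obtain x where x: "x \<in> unit_cube n"
    and fix_x: "\<And>i. i < n \<Longrightarrow> nash (simplex_retraction n x) i = x i"
  proof (rule brouwer_unit_cube[of n "\<lambda>x. nash (simplex_retraction n x)"])
    show "continuous_on (unit_cube n) (\<lambda>x. nash (simplex_retraction n x) i)" if "i < n" for i
      by (rule continuous_on_compose2[OF cont_nash[OF that] continuous_on_simplex_retraction])
        (use n simplex_retraction_in_prob_simplex in auto)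
    show "nash (simplex_retraction n x) i \<in> {0..1}" if "x \<in> unit_cube n" "i < n" for x i
    proof -
      have r: "simplex_retraction n x \<in> prob_simplex n"
        using that n simplex_retraction_in_prob_simplex by blast
      show ?thesis
        using member_le_sum[of i "{..<n}" "nash (simplex_retraction n x)"]
          nash_sum[OF r] nash_nonneg[OF r] that by auto
    qed
  qed blast
  have r: "simplex_retraction n x \<in> prob_simplex n"
    using x n simplex_retraction_in_prob_simplex by blast
  have "(\<Sum>i<n. x i) = 1"
    using nash_sum[OF r] by (simp add: fix_x)
  moreover have "0 \<le> x i" if "i < n" for i
    using nash_nonneg[OF r, of i] fix_x[OF that] by simp
  ultimately have xs: "x \<in> prob_simplex n"
    using x by (simp add: prob_simplex_def unit_cube_def) (metis linorder_not_less order_refl)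
  define G where "G = (\<Sum>j<n. gain x j)"
  have G0: "0 \<le> G" using G_nonneg by (simp add: G_def)
  have gain_eq: "gain x i = G * x i" if "i < n" for i
  proof -
    have "(x i + gain x i) / (1 + G) = x i"
      using fix_x[OF that] xs by (simp add: simplex_retraction_fixes nash_def G_def)
    then show ?thesis using G0 by (simp add: field_simps)
  qed
  have "G = 0"
  proof (rule ccontr)
    assume "G \<noteq> 0"
    with G0 have G: "G > 0" by simp
    have "x i * (a x i - avg x) = G * (x i)\<^sup>2" if "i < n" for i
    proof (cases "x i = 0")
      case False
      then have "gain x i > 0"
        using gain_eq[OF that] G xs by (simp add: prob_simplex_def less_le)
      then have "a x i - avg x = gain x i" by (simp add: gain_def max_def split: if_splits)
      then show ?thesis using gain_eq[OF that] by (simp add: power2_eq_square)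
    qed simp
    then have "G * (\<Sum>i<n. (x i)\<^sup>2) = (\<Sum>i<n. x i * (a x i - avg x))"
      by (simp add: sum_distrib_left)
    also have "\<dots> = avg x - (\<Sum>i<n. x i) * avg x"
      by (simp add: right_diff_distrib sum_subtractf sum_distrib_right avg_def)
    also have "\<dots> = 0" using xs by (simp add: prob_simplex_def)
    finally have "(\<Sum>i<n. (x i)\<^sup>2) = 0" using G by simp
    then have "\<forall>i<n. x i = 0" by (subst (asm) sum_nonneg_eq_0_iff) auto
    then show False using xs by (simp add: prob_simplex_def)
  qed
  then have "a x i \<le> avg x" if "i < n" for i
    using gain_eq[OF that] by (simp add: gain_def max_def split: if_splits)
  with xs show ?thesis using that unfolding avg_def by blast
qed

lemma continuous_map_pair_compose:
  assumes "continuous_map Y X p" "continuous_map Y X' q"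
    and "continuous_map (prod_topology X X') Z (\<lambda>(x, y). h x y)"
  shows "continuous_map Y Z (\<lambda>s. h (p s) (q s))"
  using continuous_map_compose[OF _ assms(3), of Y "\<lambda>s. (p s, q s)"] assms(1,2)
  by (simp add: continuous_map_pairwise comp_def)

text \<open>
  An inequality of Ky Fan type. The hypothesis \<open>mixture\<close> takes the place of convexity: points of the
  space can be mixed with weights from the simplex, continuously in the weights, and the payoff is
  affine along such mixtures. By compactness only finitely many deviations have to be handled at once,
  and for those the previous lemma applies to the weights of their mixtures.
\<close>

lemma equilibrium_of_mixtures:
  fixes X :: "'a topology" and \<Gamma> :: "'a \<Rightarrow> 'a \<Rightarrow> real"
  assumes compact: "compact_space X" and nonempty: "topspace X \<noteq> {}"
    and cont: "continuous_map (prod_topology X X) euclideanreal (\<lambda>(x, y). \<Gamma> x y)"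
    and mixture: "\<And>n y. n > 0 \<Longrightarrow> y \<in> {..<n} \<rightarrow> topspace X \<Longrightarrow>
      \<exists>c. continuous_map (top_of_set (prob_simplex n)) X c \<and>
        (\<forall>x\<in>topspace X. \<forall>\<theta>\<in>prob_simplex n. \<Gamma> x (c \<theta>) = (\<Sum>i<n. \<theta> i * \<Gamma> x (y i)))"
  shows "\<exists>x\<in>topspace X. \<forall>y\<in>topspace X. \<Gamma> x y \<le> \<Gamma> x x"
proof -
  note cont' = continuous_map_pair_compose[OF _ _ cont]
  define C where "C y = {x \<in> topspace X. \<Gamma> x y \<le> \<Gamma> x x}" for y
  have closed: "closedin X (C y)" if y: "y \<in> topspace X" for y
  proof -
    have "continuous_map X euclideanreal (\<lambda>x. \<Gamma> x y - \<Gamma> x x)"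
      using y by (intro continuous_map_diff cont') auto
    from closedin_continuous_map_preimage[OF this, of "{..0}"] show ?thesis
      by (simp add: C_def)
  qed
  have fin: "\<Inter>\<F> \<noteq> {}" if \<F>: "finite \<F>" "\<F> \<subseteq> C ` topspace X" "\<F> \<noteq> {}" for \<F>
  proof -
    obtain Y where Y: "finite Y" "Y \<subseteq> topspace X" "\<F> = C ` Y"
      using finite_subset_image[OF \<F>(1,2)] by blast
    define n where "n = card Y"
    obtain y where y: "bij_betw y {..<n} Y"
      using ex_bij_betw_nat_finite[OF Y(1)] by (auto simp: n_def lessThan_atLeast0)
    have n: "n > 0" using Y \<F> by (auto simp: n_def card_gt_0_iff)
    have yY: "y i \<in> topspace X" if "i < n" for i
      using y Y(2) that by (auto simp: bij_betw_def)
    then obtain c where c: "continuous_map (top_of_set (prob_simplex n)) X c"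
      and affine: "\<And>x \<theta>. x \<in> topspace X \<Longrightarrow> \<theta> \<in> prob_simplex n \<Longrightarrow>
        \<Gamma> x (c \<theta>) = (\<Sum>i<n. \<theta> i * \<Gamma> x (y i))"
      using mixture[OF n, of y] by blast
    have "continuous_on (prob_simplex n) (\<lambda>\<theta>. \<Gamma> (c \<theta>) (y i))" if "i < n" for i
    proof -
      have "continuous_map (top_of_set (prob_simplex n)) euclideanreal (\<lambda>\<theta>. \<Gamma> (c \<theta>) (y i))"
        using yY[OF that] by (intro cont' c) auto
      then show ?thesis by simp
    qed
    then obtain \<theta> where \<theta>: "\<theta> \<in> prob_simplex n"
      and best: "\<And>i. i < n \<Longrightarrow> \<Gamma> (c \<theta>) (y i) \<le> (\<Sum>j<n. \<theta> j * \<Gamma> (c \<theta>) (y j))"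
      using finite_equilibrium[OF n, of "\<lambda>\<theta> i. \<Gamma> (c \<theta>) (y i)"] by blast
    have c\<theta>: "c \<theta> \<in> topspace X"
      using c \<theta> by (auto simp: continuous_map_def)
    have "c \<theta> \<in> C v" if v: "v \<in> Y" for v
    proof -
      obtain i where "i < n" "v = y i"
        using bij_betw_imp_surj_on[OF y] v by auto
      then show ?thesis using best affine[OF c\<theta> \<theta>] c\<theta> by (simp add: C_def)
    qed
    then show ?thesis using Y(3) by auto
  qed
  have "\<Inter>(C ` topspace X) \<noteq> {}"
  proof -
    have "\<forall>K\<in>C ` topspace X. closedin X K" using closed by blast
    moreover have "\<forall>\<F>. finite \<F> \<and> \<F> \<subseteq> C ` topspace X \<longrightarrow> \<Inter>\<F> \<noteq> {}"
      using fin by (metis Inter_empty UNIV_not_empty)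
    ultimately show ?thesis
      using compact unfolding compact_space_fip by blast
  qed
  then show ?thesis using nonempty by (fastforce simp: C_def)
qed

section \<open>Weak convergence of subprobabilities\<close>

lemma topspace_weak_topology [simp]: "topspace (weak_topology S P) = P"
proof -
  have "P \<in> {{\<nu> \<in> P. (\<integral>x. h x \<partial>\<nu>) \<in> V} | h (V :: real set).
        continuous_map S euclideanreal h \<and> bounded (h ` topspace S) \<and> open V}"
    by (rule CollectI, rule exI[of _ "\<lambda>_. 0"], rule exI[of _ UNIV])
      (auto simp: image_constant_conv)
  then show ?thesis
    unfolding weak_topology_def topology_generated_by_topspace by blast
qed

lemma continuous_map_integral_weak_topology:
  assumes "continuous_map S euclideanreal h" "bounded (h ` topspace S)"
  shows "continuous_map (weak_topology S P) euclideanreal (\<lambda>\<nu>. \<integral>x. h x \<partial>\<nu>)"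
  unfolding continuous_map_def
proof (intro conjI allI impI)
  fix V :: "real set" assume "openin euclideanreal V"
  then show "openin (weak_topology S P) {\<nu> \<in> topspace (weak_topology S P). (\<integral>x. h x \<partial>\<nu>) \<in> V}"
    unfolding topspace_weak_topology using assms
    unfolding weak_topology_def by (intro topology_generated_by_Basis) auto
qed simp

lemma continuous_map_into_weak_topology:
  assumes "\<And>y. y \<in> topspace Y \<Longrightarrow> c y \<in> P"
    and "\<And>h. continuous_map S euclideanreal h \<Longrightarrow> bounded (h ` topspace S) \<Longrightarrow>
      continuous_map Y euclideanreal (\<lambda>y. \<integral>x. h x \<partial>c y)"
  shows "continuous_map Y (weak_topology S P) c"
  unfolding weak_topology_def
proof (rule continuous_on_generated_topo)
  fix G assume "G \<in> {{\<nu> \<in> P. (\<integral>x. h x \<partial>\<nu>) \<in> V} | h (V :: real set).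
        continuous_map S euclideanreal h \<and> bounded (h ` topspace S) \<and> open V}"
  then obtain h V where h: "continuous_map S euclideanreal h" "bounded (h ` topspace S)"
    and V: "open V" and G: "G = {\<nu> \<in> P. (\<integral>x. h x \<partial>\<nu>) \<in> V}"
    by auto
  have "openin Y {y \<in> topspace Y. (\<integral>x. h x \<partial>c y) \<in> V}"
    using openin_continuous_map_preimage[OF assms(2)[OF h], of V] V by simp
  moreover have "{y \<in> topspace Y. (\<integral>x. h x \<partial>c y) \<in> V} = c -` G \<inter> topspace Y"
    using assms(1) G by auto
  ultimately show "openin Y (c -` G \<inter> topspace Y)" by simp
next
  show "c ` topspace Y \<subseteq> \<Union> {{\<nu> \<in> P. (\<integral>x. h x \<partial>\<nu>) \<in> V} | h (V :: real set).
        continuous_map S euclideanreal h \<and> bounded (h ` topspace S) \<and> open V}"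
    using assms(1) topspace_weak_topology[of S P]
    unfolding weak_topology_def topology_generated_by_topspace by blast
qed

lemma space_borel_on [simp]: "space (borel_on K) = K"
  by (simp add: borel_on_def space_restrict_space)

lemma measurable_borel_on_continuous:
  fixes h :: "'e::metric_space \<Rightarrow> real"
  assumes "continuous_on K h"
  shows "h \<in> borel_measurable (borel_on K)"
  unfolding borel_on_def using assms by (rule borel_measurable_continuous_on_restrict)

lemma subprobs_onD:
  assumes "\<nu> \<in> subprobs_on K"
  shows "subprob_space \<nu>" "sets \<nu> = sets (borel_on K)" "space \<nu> = K"
  using assms sets_eq_imp_space_eq[of \<nu> "borel_on K"]
  by (auto simp: subprobs_on_def space_subprob_algebra)

lemma subprobs_on_integrable:
  fixes h :: "'e::metric_space \<Rightarrow> real"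
  assumes \<nu>: "\<nu> \<in> subprobs_on K" and h: "h \<in> borel_measurable (borel_on K)"
    and b: "\<And>x. x \<in> K \<Longrightarrow> \<bar>h x\<bar> \<le> b"
  shows "integrable \<nu> h"
proof -
  interpret subprob_space \<nu> using subprobs_onD(1)[OF \<nu>] .
  have "h \<in> borel_measurable \<nu>"
    using h measurable_cong_sets[OF subprobs_onD(2)[OF \<nu>] refl] by blast
  then show ?thesis
    using b subprobs_onD(3)[OF \<nu>] by (intro integrable_const_bound[of _ b]) auto
qed

lemma continuous_on_compact_bounded:
  fixes h :: "'e::metric_space \<Rightarrow> real"
  assumes "compact K" "continuous_on K h"
  obtains b where "\<And>x. x \<in> K \<Longrightarrow> \<bar>h x\<bar> \<le> b"
  using compact_imp_bounded[OF compact_continuous_image[OF assms(2,1)]]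
  by (auto simp: bounded_iff)

lemma subprobs_on_integrable_continuous:
  fixes h :: "'e::metric_space \<Rightarrow> real"
  assumes "\<nu> \<in> subprobs_on K" "compact K" "continuous_on K h"
  shows "integrable \<nu> h"
  using continuous_on_compact_bounded[OF assms(2,3)]
    subprobs_on_integrable[OF assms(1) measurable_borel_on_continuous[OF assms(3)]]
  by metis

text \<open>
  Total mass at most 1 keeps a uniform bound on the integrands. The statement covers Lebesgue measure on
  an interval \<open>[0, s)\<close> with \<open>0 \<le> s \<le> 1\<close>, including the empty one.
\<close>

lemma subprob_integral_close:
  fixes h h' :: "'a \<Rightarrow> real"
  assumes "finite_measure \<nu>" and le_1: "measure \<nu> (space \<nu>) \<le> 1"
    and h: "integrable \<nu> h" "integrable \<nu> h'"
    and e: "\<And>x. x \<in> space \<nu> \<Longrightarrow> \<bar>h x - h' x\<bar> \<le> e" and "0 \<le> e"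
  shows "\<bar>(\<integral>x. h x \<partial>\<nu>) - (\<integral>x. h' x \<partial>\<nu>)\<bar> \<le> e"
proof -
  interpret finite_measure \<nu> by fact
  have "\<bar>(\<integral>x. h x \<partial>\<nu>) - (\<integral>x. h' x \<partial>\<nu>)\<bar> = \<bar>\<integral>x. h x - h' x \<partial>\<nu>\<bar>"
    using h by simp
  also have "\<dots> \<le> (\<integral>x. \<bar>h x - h' x\<bar> \<partial>\<nu>)" by (rule integral_abs_bound)
  also have "\<dots> \<le> (\<integral>x. e \<partial>\<nu>)"
    using h e by (intro integral_mono) auto
  also have "\<dots> = measure \<nu> (space \<nu>) * e" by simp
  also have "\<dots> \<le> e" using le_1 \<open>0 \<le> e\<close> by (simp add: mult_left_le_one_le)
  finally show ?thesis .
qed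

lemma subprobs_on_integral_close:
  fixes h h' :: "'e::metric_space \<Rightarrow> real"
  assumes \<nu>: "\<nu> \<in> subprobs_on K" and h: "integrable \<nu> h" "integrable \<nu> h'"
    and e: "\<And>x. x \<in> K \<Longrightarrow> \<bar>h x - h' x\<bar> \<le> e" and "0 \<le> e"
  shows "\<bar>(\<integral>x. h x \<partial>\<nu>) - (\<integral>x. h' x \<partial>\<nu>)\<bar> \<le> e"
proof -
  interpret subprob_space \<nu> using subprobs_onD(1)[OF \<nu>] .
  show ?thesis
    using e subprobs_onD(3)[OF \<nu>] subprob_measure_le_1 \<open>0 \<le> e\<close>
    by (intro subprob_integral_close finite_measure_axioms h) auto
qed

text \<open>
  Enumerate the balls of finite covers with radii \<open>1/(m + 1)\<close>. Each point lies in some ball of the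
  \<open>m\<close>-th cover, so two points that lie in the same balls are closer than \<open>2/(m + 1)\<close>.
\<close>

lemma compact_separating_open_sets:
  fixes K :: "'e::metric_space set"
  assumes "compact K"
  obtains B :: "nat \<Rightarrow> 'e set" where "\<And>i. open (B i)"
    and "\<And>\<epsilon>. 0 < \<epsilon> \<Longrightarrow> \<exists>N. \<forall>x\<in>K. \<forall>y\<in>K. (\<forall>i<N. x \<in> B i \<longleftrightarrow> y \<in> B i) \<longrightarrow> dist x y < \<epsilon>"
proof -
  have "\<exists>C. finite C \<and> K \<subseteq> (\<Union>c\<in>C. ball c (inverse (real (Suc m))))" for m
    using compact_imp_seq_compact[OF assms, THEN seq_compact_imp_totally_bounded, rule_format,
        of "inverse (real (Suc m))"] by auto
  then obtain C where C: "\<And>m. finite (C m)"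
    and cover: "\<And>m. K \<subseteq> (\<Union>c\<in>C m. ball c (inverse (real (Suc m))))"
    by metis
  define \<B> where "\<B> = insert {} (\<Union>m. (\<lambda>c. ball c (inverse (real (Suc m)))) ` C m)"
  have cnt: "countable \<B>" "\<B> \<noteq> {}"
    unfolding \<B>_def
    by (intro countable_insert countable_UN countable_image countableI_type countable_finite C) simp
  define B where "B = from_nat_into \<B>"
  have range: "range B = \<B>" unfolding B_def using cnt by (simp add: range_from_nat_into)
  show ?thesis
  proof
    have "\<And>S. S \<in> \<B> \<Longrightarrow> open S" by (auto simp: \<B>_def)
    then show "open (B i)" for i using range by blast
    fix \<epsilon> :: real assume "0 < \<epsilon>"
    then obtain m where m: "inverse (real (Suc m)) < \<epsilon> / 2"
      using reals_Archimedean[of "\<epsilon> / 2"] by auto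
    have "\<forall>c\<in>C m. \<exists>i. B i = ball c (inverse (real (Suc m)))"
    proof
      fix c assume "c \<in> C m"
      then have "ball c (inverse (real (Suc m))) \<in> range B" unfolding range \<B>_def by blast
      then show "\<exists>i. B i = ball c (inverse (real (Suc m)))" by (metis rangeE)
    qed
    from bchoice[OF this] obtain k
      where k: "\<And>c. c \<in> C m \<Longrightarrow> B (k c) = ball c (inverse (real (Suc m)))" by blast
    have "finite (k ` C m)" using C by simp
    then obtain N where N: "\<And>c. c \<in> C m \<Longrightarrow> k c < N"
      using finite_nat_set_iff_bounded[of "k ` C m"] by auto
    have "dist x y < \<epsilon>" if "x \<in> K" "y \<in> K" "\<forall>i<N. x \<in> B i \<longleftrightarrow> y \<in> B i" for x y
    proof -
      obtain c where c: "c \<in> C m" "x \<in> ball c (inverse (real (Suc m)))"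
        using cover[of m] \<open>x \<in> K\<close> by blast
      then have "y \<in> ball c (inverse (real (Suc m)))"
        using \<open>\<forall>i<N. x \<in> B i \<longleftrightarrow> y \<in> B i\<close> N[OF c(1)] k[OF c(1)] by metis
      with c(2) m show ?thesis
        using dist_triangle2[of x y c] by (auto simp: dist_commute)
    qed
    then show "\<exists>N. \<forall>x\<in>K. \<forall>y\<in>K. (\<forall>i<N. x \<in> B i \<longleftrightarrow> y \<in> B i) \<longrightarrow> dist x y < \<epsilon>" by blast
  qed
qed

section \<open>Compactness of the subprobabilities on a compact metric space\<close>

text \<open>
  The values on sets that are not Borel are arbitrary numbers in \<open>[0, 1]\<close>. This keeps the set a closed
  subset of a full power of \<open>[0, 1]\<close>.
\<close>

definition additive_subprobs :: "'e::metric_space set \<Rightarrow> ('e set \<Rightarrow> real) set" where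
  "additive_subprobs K = {a. (\<forall>A. a A \<in> {0..1}) \<and>
     (\<forall>A\<in>sets (borel_on K). \<forall>A'\<in>sets (borel_on K). A \<inter> A' = {} \<longrightarrow> a (A \<union> A') = a A + a A')}"

text \<open>
  Tychonoff's theorem for the power of \<open>[0, 1]\<close>; each instance of additivity is a closed condition
  on three coordinates. Countable additivity is not a closed condition; it is regained by passing from
  \<open>a\<close> to another set function, the measure that integrates continuous functions as the limit of the
  Riemann sums of \<open>a\<close>.
\<close>

lemma compact_additive_subprobs: "compact (additive_subprobs K)"
proof -
  have "compactin (product_topology (\<lambda>i. euclideanreal) UNIV) (PiE (UNIV :: 'a set set) (\<lambda>i. {0..1}))"
    unfolding compactin_PiE by auto
  then have 1: "compact (PiE (UNIV :: 'a set set) (\<lambda>i. {0..1::real}))"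
    by (simp add: euclidean_product_topology)
  have 2: "closed {a :: 'a set \<Rightarrow> real. a (A \<union> A') = a A + a A'}" for A A'
    by (intro closed_Collect_eq continuous_intros continuous_on_product_coordinates)
  have "additive_subprobs K = PiE UNIV (\<lambda>i. {0..1}) \<inter>
     (\<Inter>A\<in>sets (borel_on K). \<Inter>A'\<in>{A'\<in>sets (borel_on K). A \<inter> A' = {}}.
        {a. a (A \<union> A') = a A + a A'})"
    by (auto simp: additive_subprobs_def PiE_UNIV_domain Pi_iff)
  then show ?thesis
    by (simp only:) (intro compact_Int_closed 1 closed_INT ballI 2)
qed

text \<open>
  The memberships of a point in \<open>B 0, \<dots>, B (n - 1)\<close>, read as binary digits, number the cells of the
  \<open>n\<close>-th partition of \<open>K\<close> by naturals below \<open>2 ^ n\<close>. The new digit is the least significant one, so cell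
  \<open>j\<close> splits into the adjacent cells \<open>2 * j\<close> and \<open>2 * j + 1\<close>.
\<close>

locale coded_compact =
  fixes K :: "'e::metric_space set" and B :: "nat \<Rightarrow> 'e set"
  assumes compact_K: "compact K" and K_nonempty: "K \<noteq> {}"
    and open_B: "\<And>i. open (B i)"
    and separates: "\<And>\<epsilon>. 0 < \<epsilon> \<Longrightarrow>
      \<exists>N. \<forall>x\<in>K. \<forall>y\<in>K. (\<forall>i<N. x \<in> B i \<longleftrightarrow> y \<in> B i) \<longrightarrow> dist x y < \<epsilon>"
begin

fun code :: "nat \<Rightarrow> 'e \<Rightarrow> nat" where
  "code 0 x = 0"
| "code (Suc n) x = 2 * code n x + (if x \<in> B n then 1 else 0)"

text \<open>
  Cells may be empty; then the representative is an arbitrary point of \<open>K\<close>.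
\<close>

definition rep :: "nat \<Rightarrow> nat \<Rightarrow> 'e" where
  "rep n j = (if \<exists>x\<in>K. code n x = j then SOME x. x \<in> K \<and> code n x = j else SOME x. x \<in> K)"

lemma rep_in: "rep n j \<in> K"
proof (cases "\<exists>x\<in>K. code n x = j")
  case True
  then show ?thesis unfolding rep_def using someI_ex[of "\<lambda>x. x \<in> K \<and> code n x = j"] by auto
next
  case False
  then show ?thesis unfolding rep_def using some_in_eq[of K] K_nonempty by auto
qed

lemma code_rep: "x \<in> K \<Longrightarrow> code n x = j \<Longrightarrow> code n (rep n j) = j"
  unfolding rep_def using someI_ex[of "\<lambda>x. x \<in> K \<and> code n x = j"] by auto

lemma code_less: "code n x < 2 ^ n"
  by (induction n) auto

lemma code_Suc_div: "code (Suc n) x div 2 = code n x"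
  by simp

lemma code_eq_iff: "code n x = code n y \<longleftrightarrow> (\<forall>i<n. x \<in> B i \<longleftrightarrow> y \<in> B i)"
proof (induction n)
  case (Suc n)
  have "code (Suc n) x = code (Suc n) y \<longleftrightarrow> code n x = code n y \<and> (x \<in> B n \<longleftrightarrow> y \<in> B n)"
    by (auto; presburger)
  then show ?case using Suc less_Suc_eq by auto
qed simp

lemma code_separates: "0 < \<epsilon> \<Longrightarrow>
  \<exists>N. \<forall>n\<ge>N. \<forall>x\<in>K. \<forall>y\<in>K. code n x = code n y \<longrightarrow> dist x y < \<epsilon>"
proof -
  assume "0 < \<epsilon>"
  then obtain N where "\<forall>x\<in>K. \<forall>y\<in>K. (\<forall>i<N. x \<in> B i \<longleftrightarrow> y \<in> B i) \<longrightarrow> dist x y < \<epsilon>"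
    using separates by blast
  then show ?thesis unfolding code_eq_iff by (intro exI[of _ N]) (meson order.strict_trans2)
qed

lemma measurable_code: "code n \<in> measurable (borel_on K) (count_space UNIV)"
proof (induction n)
  case (Suc n)
  have "B n \<in> sets borel" using open_B by simp
  then have [measurable]: "Measurable.pred (borel_on K) (\<lambda>x. x \<in> B n)"
    by (auto simp: pred_def borel_on_def sets_restrict_space space_restrict_space)
  note Suc[measurable]
  show ?case unfolding code.simps by measurable
qed simp

definition below :: "nat \<Rightarrow> nat \<Rightarrow> 'e set" where
  "below n j = {x \<in> K. code n x < j}"

definition cell :: "nat \<Rightarrow> nat \<Rightarrow> 'e set" where
  "cell n j = {x \<in> K. code n x = j}"

lemma below_sets: "below n j \<in> sets (borel_on K)"
  using measurable_sets[OF measurable_code, of "{..<j}" n]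
  by (simp add: below_def vimage_def Int_def conj_commute)

lemma cell_sets: "cell n j \<in> sets (borel_on K)"
  using measurable_sets[OF measurable_code, of "{j}" n]
  by (simp add: cell_def vimage_def Int_def conj_commute)

text \<open>
  The left end point of the interval that level \<open>n\<close> assigns to cell \<open>j\<close>.
\<close>

definition cum :: "('e set \<Rightarrow> real) \<Rightarrow> nat \<Rightarrow> nat \<Rightarrow> real" where
  "cum a n j = a (below n j)"

text \<open>
  The Riemann sum of \<open>h\<close> for the \<open>n\<close>-th partition. It depends continuously on \<open>a\<close>, since it involves
  finitely many of its values.
\<close>

definition approx :: "('e \<Rightarrow> real) \<Rightarrow> nat \<Rightarrow> ('e set \<Rightarrow> real) \<Rightarrow> real" where
  "approx h n a = (\<Sum>j<2 ^ n. a (cell n j) * h (rep n j))"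

text \<open>
  The error of the Riemann sums is bounded by the oscillation of \<open>h\<close> on the cells, in the same way for
  genuine measures here and for the measure constructed from \<open>a\<close> below. This common bound makes the
  convergence uniform in \<open>a\<close>.
\<close>

lemma approx_close_integral:
  assumes \<nu>: "\<nu> \<in> subprobs_on K" and h: "continuous_on K h" and "0 \<le> e"
    and e: "\<And>x y. x \<in> K \<Longrightarrow> y \<in> K \<Longrightarrow> code n x = code n y \<Longrightarrow> \<bar>h x - h y\<bar> \<le> e"
  shows "\<bar>approx h n (measure \<nu>) - (\<integral>x. h x \<partial>\<nu>)\<bar> \<le> e"
proof -
  interpret subprob_space \<nu> using subprobs_onD(1)[OF \<nu>] .
  let ?s = "\<lambda>x. \<Sum>j<2 ^ n. indicator (cell n j) x * h (rep n j)"
  have cells: "cell n j \<in> sets \<nu>" for j using cell_sets subprobs_onD(2)[OF \<nu>] by simp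
  have int: "integrable \<nu> (\<lambda>x. indicator (cell n j) x * h (rep n j))" for j
    using cells by (intro integrable_mult_left integrable_real_indicator) (auto simp: emeasure_eq_measure)
  have s: "?s x = h (rep n (code n x))" if "x \<in> K" for x
  proof -
    have "?s x = (\<Sum>j<2 ^ n. if j = code n x then h (rep n (code n x)) else 0)"
      using that by (intro sum.cong) (auto simp: cell_def indicator_def)
    then show ?thesis using code_less by simp
  qed
  have "approx h n (measure \<nu>) = (\<integral>x. ?s x \<partial>\<nu>)"
  proof -
    have "(\<integral>x. ?s x \<partial>\<nu>) = (\<Sum>j<2 ^ n. \<integral>x. indicator (cell n j) x * h (rep n j) \<partial>\<nu>)"
      by (rule Bochner_Integration.integral_sum) (rule int)
    also have "\<dots> = approx h n (measure \<nu>)"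
      unfolding approx_def using cells by (intro sum.cong) (auto simp: sets.Int_space_eq2)
    finally show ?thesis ..
  qed
  moreover have "\<bar>(\<integral>x. ?s x \<partial>\<nu>) - (\<integral>x. h x \<partial>\<nu>)\<bar> \<le> e"
  proof (rule subprobs_on_integral_close[OF \<nu>])
    show "integrable \<nu> ?s" using int by (rule Bochner_Integration.integrable_sum)
    show "integrable \<nu> h" by (rule subprobs_on_integrable_continuous[OF \<nu> compact_K h])
    fix x assume x: "x \<in> K"
    show "\<bar>?s x - h x\<bar> \<le> e"
      unfolding s[OF x] using e[OF rep_in x] code_rep[OF x refl] by blast
  qed fact
  ultimately show ?thesis by simp
qed

end

text \<open>
  A finitely additive \<open>a\<close> is turned into a measure. The interval of cell \<open>j\<close> at level \<open>n\<close> is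
  \<open>[cum a n j, cum a n (j + 1))\<close>, of length \<open>a (cell n j)\<close>; intervals of subcells subdivide it
  (\<open>cum_double\<close>).
\<close>

locale coded_additive = coded_compact +
  fixes a :: "'a set \<Rightarrow> real"
  assumes a: "a \<in> additive_subprobs K"
begin

lemma a_nonneg: "0 \<le> a A" and a_le_1: "a A \<le> 1"
  using a by (auto simp: additive_subprobs_def)

lemma a_add: "A \<in> sets (borel_on K) \<Longrightarrow> A' \<in> sets (borel_on K) \<Longrightarrow> A \<inter> A' = {} \<Longrightarrow>
    a (A \<union> A') = a A + a A'"
  using a by (auto simp: additive_subprobs_def)

lemma cum_Suc: "cum a n (Suc j) = cum a n j + a (cell n j)"
proof -
  have "below n (Suc j) = below n j \<union> cell n j" "below n j \<inter> cell n j = {}"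
    by (auto simp: below_def cell_def)
  then show ?thesis unfolding cum_def using a_add below_sets cell_sets by metis
qed

lemma cum_0: "cum a n 0 = 0"
  using a_add[of "{}" "{}"] by (simp add: cum_def below_def)

lemma cum_nonneg: "0 \<le> cum a n j"
  by (simp add: cum_def a_nonneg)

lemma cum_mono: "i \<le> j \<Longrightarrow> cum a n i \<le> cum a n j"
  by (rule lift_Suc_mono_le[of "cum a n"]) (auto simp: cum_Suc a_nonneg)

lemma cum_double: "cum a (Suc n) (2 * j) = cum a n j"
proof -
  have "below (Suc n) (2 * j) = below n j" by (auto simp: below_def)
  then show ?thesis by (simp add: cum_def)
qed

lemma cum_top: "cum a n (2 ^ n) = a K"
  using code_less by (simp add: cum_def below_def)

text \<open>
  The cell of level \<open>n\<close> whose interval contains \<open>r\<close>.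
\<close>

definition pos :: "nat \<Rightarrow> real \<Rightarrow> nat" where
  "pos n r = (LEAST j. r < cum a n (Suc j))"

lemma pos_bounds:
  assumes "0 \<le> r" "r < a K"
  shows "cum a n (pos n r) \<le> r" "r < cum a n (Suc (pos n r))"
proof -
  have "\<exists>j. r < cum a n (Suc j)"
    using assms(2) cum_top[of n] by (intro exI[of _ "2 ^ n - 1"]) simp
  then show "r < cum a n (Suc (pos n r))" unfolding pos_def by (rule LeastI_ex)
  show "cum a n (pos n r) \<le> r"
  proof (cases "pos n r")
    case 0
    then show ?thesis using assms(1) by (simp add: cum_0)
  next
    case (Suc k)
    then have "\<not> r < cum a n (Suc k)"
      using not_less_Least[of k "\<lambda>j. r < cum a n (Suc j)"] by (simp add: pos_def)
    then show ?thesis using Suc by simp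
  qed
qed

lemma pos_unique:
  assumes "cum a n j \<le> r" "r < cum a n (Suc j)"
  shows "pos n r = j"
  unfolding pos_def
proof (rule Least_equality)
  fix k assume "r < cum a n (Suc k)"
  show "j \<le> k"
  proof (rule ccontr)
    assume "\<not> j \<le> k"
    then have "cum a n (Suc k) \<le> cum a n j" by (intro cum_mono) simp
    with assms(1) \<open>r < cum a n (Suc k)\<close> show False by simp
  qed
qed fact

lemma cum_le_total: "cum a n j \<le> a K"
proof -
  have "below n j \<union> (K - below n j) = K" by (auto simp: below_def)
  moreover have "K - below n j \<in> sets (borel_on K)"
    using sets.compl_sets[OF below_sets] by simp
  ultimately have "a K = a (below n j) + a (K - below n j)"
    using a_add[OF below_sets, of "K - below n j" n j] by auto
  then show ?thesis using a_nonneg by (simp add: cum_def)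
qed

lemma pos_eq_iff:
  assumes "0 \<le> r" "r < a K"
  shows "pos n r = j \<longleftrightarrow> cum a n j \<le> r \<and> r < cum a n (Suc j)"
  using pos_bounds[OF assms] pos_unique by blast

lemma pos_nested:
  assumes "0 \<le> r" "r < a K"
  shows "pos (Suc n) r div 2 = pos n r"
proof (rule sym, rule pos_unique)
  let ?k = "pos (Suc n) r"
  have "cum a n (?k div 2) = cum a (Suc n) (2 * (?k div 2))" by (simp only: cum_double)
  also have "\<dots> \<le> cum a (Suc n) ?k" by (rule cum_mono) simp
  also have "\<dots> \<le> r" by (rule pos_bounds[OF assms])
  finally show "cum a n (?k div 2) \<le> r" .
  have "r < cum a (Suc n) (Suc ?k)" by (rule pos_bounds[OF assms])
  also have "\<dots> \<le> cum a (Suc n) (2 * Suc (?k div 2))" by (rule cum_mono) simp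
  also have "\<dots> = cum a n (Suc (?k div 2))" by (rule cum_double)
  finally show "r < cum a n (Suc (?k div 2))" .
qed

definition point :: "nat \<Rightarrow> real \<Rightarrow> 'a" where
  "point n r = rep n (pos n r)"

text \<open>
  A cell whose interval contains a point has positive length, hence is nonempty, so its representative
  really lies in it. Since the intervals are nested, so are the cells.
\<close>

lemma code_point:
  assumes r: "0 \<le> r" "r < a K" and "n \<le> m"
  shows "code n (point m r) = pos n r"
  using \<open>n \<le> m\<close>
proof (induction rule: inc_induct)
  case base
  have "cell m (pos m r) \<noteq> {}"
  proof
    assume "cell m (pos m r) = {}"
    moreover have "a {} = 0" using cum_0[of 0] by (simp add: cum_def below_def)
    ultimately show False using pos_bounds[OF r, of m] by (simp add: cum_Suc)
  qed
  then show ?case unfolding point_def cell_def using code_rep by blast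
next
  case (step k)
  then show ?case using pos_nested[OF r, of k] code_Suc_div[of k "point m r"] by simp
qed

lemma code_point_eq:
  assumes r: "0 \<le> r" "r < a K" and "n \<le> m"
  shows "code n (point n r) = code n (point m r)"
  using code_point[OF r] \<open>n \<le> m\<close> by (metis order_refl)

lemma point_in: "point n r \<in> K"
  by (simp add: point_def rep_in)

definition limit_point :: "real \<Rightarrow> 'a" where
  "limit_point r = lim (\<lambda>n. point n r)"

text \<open>
  From level \<open>n\<close> on, all approximating points have the same code at level \<open>n\<close>, and equal codes of high
  level force small distance.
\<close>

lemma limit_point:
  assumes r: "0 \<le> r" "r < a K"
  shows "(\<lambda>n. point n r) \<longlonglongrightarrow> limit_point r" "limit_point r \<in> K"
proof -
  have "Cauchy (\<lambda>n. point n r)"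
  proof (rule metric_CauchyI)
    fix \<epsilon> :: real assume "0 < \<epsilon>"
    then obtain N where N: "\<And>n x y. n \<ge> N \<Longrightarrow> x \<in> K \<Longrightarrow> y \<in> K \<Longrightarrow> code n x = code n y \<Longrightarrow>
        dist x y < \<epsilon>"
      using code_separates by blast
    have "dist (point m r) (point n r) < \<epsilon>" if "m \<ge> N" "n \<ge> N" for m n
    proof (rule N[of N])
      show "code N (point m r) = code N (point n r)"
        using code_point_eq[OF r] that by metis
    qed (auto simp: point_in)
    then show "\<exists>M. \<forall>m\<ge>M. \<forall>n\<ge>M. dist (point m r) (point n r) < \<epsilon>" by blast
  qed
  then obtain l where l: "l \<in> K" "(\<lambda>n. point n r) \<longlonglongrightarrow> l"
    using completeE[OF compact_imp_complete[OF compact_K], of "\<lambda>n. point n r"] point_in by metis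
  from l(2) have "limit_point r = l" unfolding limit_point_def by (rule limI)
  with l show "(\<lambda>n. point n r) \<longlonglongrightarrow> limit_point r" "limit_point r \<in> K" by auto
qed

definition base :: "real measure" where
  "base = restrict_space lborel {0..<a K}"

lemma space_base: "space base = {0..<a K}"
  by (simp add: base_def space_restrict_space)

lemma finite_measure_base: "finite_measure base"
  by (rule finite_measureI) (simp add: space_base, simp add: base_def emeasure_restrict_space a_nonneg)

lemma measure_base: "measure base (space base) = a K"
  unfolding space_base by (simp add: base_def measure_restrict_space a_nonneg)

lemma pos_vimage: "{r \<in> space base. pos n r = j} = {cum a n j..<cum a n (Suc j)}"
proof -
  have "0 \<le> cum a n j" by (rule cum_nonneg)
  moreover have "cum a n (Suc j) \<le> a K" by (rule cum_le_total)
  ultimately show ?thesis using pos_eq_iff by (fastforce simp: space_base)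
qed

lemma measurable_pos: "pos n \<in> measurable base (count_space UNIV)"
proof -
  have "pos n -` {j} \<inter> space base \<in> sets base" for j
  proof -
    have "pos n -` {j} \<inter> space base = {cum a n j..<cum a n (Suc j)}"
      using pos_vimage[of n j] by auto
    then show ?thesis
      using cum_nonneg[of n j] cum_le_total[of n "Suc j"]
      by (auto simp: base_def sets_restrict_space_iff)
  qed
  then show ?thesis by (simp add: measurable_count_space_eq2_countable)
qed

lemma measurable_limit_point: "limit_point \<in> measurable base (borel_on K)"
proof -
  have "limit_point \<in> borel_measurable base"
  proof (rule borel_measurable_LIMSEQ_metric)
    show "point n \<in> borel_measurable base" for n
      unfolding point_def by (rule measurable_compose[OF measurable_pos]) simp
    show "(\<lambda>n. point n r) \<longlonglongrightarrow> limit_point r" if "r \<in> space base" for r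
      using limit_point that by (simp add: space_base)
  qed
  then show ?thesis
    unfolding borel_on_def using limit_point
    by (intro measurable_restrict_space2) (auto simp: space_base)
qed

text \<open>
  The set of \<open>r\<close> with \<open>pos n r = j\<close> has length \<open>a (cell n j)\<close>.
\<close>

lemma approx_eq_integral: "integrable base (\<lambda>r. h (point n r))"
    "approx h n a = (\<integral>r. h (point n r) \<partial>base)"
proof -
  interpret finite_measure base by (rule finite_measure_base)
  define S where "S j = {cum a n j..<cum a n (Suc j)}" for j
  have S: "S j \<subseteq> space base" "S j \<in> sets base" "S j = {r \<in> space base. pos n r = j}" for j
    using pos_vimage[of n j] measurable_sets[OF measurable_pos, of "{j}" n]
    by (auto simp: S_def vimage_def Int_def conj_commute)
  have mS: "measure base (S j) = a (cell n j)" for j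
  proof -
    have "measure base (S j) = measure lborel (S j)"
      unfolding base_def using S(1)[of j] by (intro measure_restrict_space) (auto simp: space_base)
    then show ?thesis using cum_mono[of j "Suc j" n] by (simp add: S_def cum_Suc)
  qed
  have int: "integrable base (\<lambda>r. indicator (S j) r * h (rep n j))" for j
    using S(2) by (intro integrable_mult_left integrable_real_indicator) (auto simp: emeasure_eq_measure)
  let ?s = "\<lambda>r. \<Sum>j<2 ^ n. indicator (S j) r * h (rep n j)"
  have s: "?s r = h (point n r)" if r: "r \<in> space base" for r
  proof -
    have "pos n r < 2 ^ n"
    proof -
      have "pos n r = code n (point n r)" using code_point[of r n n] r by (simp add: space_base)
      then show ?thesis using code_less by simp
    qed
    moreover have "?s r = (\<Sum>j<2 ^ n. if j = pos n r then h (point n r) else 0)"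
      using r by (intro sum.cong) (auto simp: S(3) indicator_def point_def)
    ultimately show ?thesis by simp
  qed
  have "integrable base ?s" using int by (rule Bochner_Integration.integrable_sum)
  moreover have "integrable base ?s \<longleftrightarrow> integrable base (\<lambda>r. h (point n r))"
    by (rule Bochner_Integration.integrable_cong) (use s in auto)
  ultimately show "integrable base (\<lambda>r. h (point n r))" by blast
  have "(\<integral>r. h (point n r) \<partial>base) = (\<integral>r. ?s r \<partial>base)"
    by (rule Bochner_Integration.integral_cong) (use s in auto)
  also have "\<dots> = (\<Sum>j<2 ^ n. \<integral>r. indicator (S j) r * h (rep n j) \<partial>base)"
    by (rule Bochner_Integration.integral_sum) (rule int)
  also have "\<dots> = approx h n a"
    unfolding approx_def using S(2) by (intro sum.cong) (auto simp: mS sets.Int_space_eq2)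
  finally show "approx h n a = (\<integral>r. h (point n r) \<partial>base)" ..
qed

definition representing_measure :: "'a measure" where
  "representing_measure = distr base (borel_on K) limit_point"

lemma representing_measure_in: "representing_measure \<in> subprobs_on K"
proof -
  interpret finite_measure base by (rule finite_measure_base)
  have "limit_point -` K \<inter> space base = space base"
    using measurable_space[OF measurable_limit_point] by auto
  then have "emeasure representing_measure (space representing_measure) = emeasure base (space base)"
    using emeasure_distr[OF measurable_limit_point sets.top]
    by (simp add: representing_measure_def)
  also have "\<dots> \<le> 1" using measure_base a_le_1[of K] by (simp add: emeasure_eq_measure)
  finally have "subprob_space representing_measure"
    using K_nonempty by (intro subprob_spaceI) (auto simp: representing_measure_def)
  then show ?thesis
    by (simp add: subprobs_on_def space_subprob_algebra representing_measure_def)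
qed

text \<open>
  All later approximating points, hence in the limit the values of \<open>h\<close> at the limit point, stay within
  the oscillation of \<open>h\<close> on the cell of level \<open>n\<close>. The limit point itself may lie outside the cell.
\<close>

lemma approx_close_representing:
  assumes h: "continuous_on K h" and "0 \<le> e"
    and e: "\<And>x y. x \<in> K \<Longrightarrow> y \<in> K \<Longrightarrow> code n x = code n y \<Longrightarrow> \<bar>h x - h y\<bar> \<le> e"
  shows "\<bar>approx h n a - (\<integral>x. h x \<partial>representing_measure)\<bar> \<le> e"
proof -
  interpret finite_measure base by (rule finite_measure_base)
  have hm: "h \<in> borel_measurable (borel_on K)" by (rule measurable_borel_on_continuous[OF h])
  obtain b where b: "\<And>x. x \<in> K \<Longrightarrow> \<bar>h x\<bar> \<le> b"
    using continuous_on_compact_bounded[OF compact_K h] by blast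
  have "\<bar>(\<integral>r. h (point n r) \<partial>base) - (\<integral>r. h (limit_point r) \<partial>base)\<bar> \<le> e"
  proof (rule subprob_integral_close[OF finite_measure_base])
    show "integrable base (\<lambda>r. h (limit_point r))"
      using b measurable_compose[OF measurable_limit_point hm] limit_point(2)
      by (intro integrable_const_bound[of _ b]) (auto simp: space_base)
    fix r assume "r \<in> space base"
    then have r: "0 \<le> r" "r < a K" by (auto simp: space_base)
    have "(\<lambda>m. h (point m r)) \<longlonglongrightarrow> h (limit_point r)"
      by (rule continuous_on_tendsto_compose[OF h limit_point(1)[OF r] limit_point(2)[OF r]])
        (simp add: point_in)
    then have "(\<lambda>m. \<bar>h (point n r) - h (point m r)\<bar>) \<longlonglongrightarrow> \<bar>h (point n r) - h (limit_point r)\<bar>"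
      by (intro tendsto_intros)
    moreover have "\<forall>m\<ge>n. \<bar>h (point n r) - h (point m r)\<bar> \<le> e"
      using e[OF point_in point_in] code_point_eq[OF r] by blast
    ultimately show "\<bar>h (point n r) - h (limit_point r)\<bar> \<le> e"
      by (intro LIMSEQ_le_const2) auto
  qed (use a_le_1 measure_base approx_eq_integral \<open>0 \<le> e\<close> in auto)
  then show ?thesis
    unfolding approx_eq_integral(2) representing_measure_def
    using integral_distr[OF measurable_limit_point hm] by simp
qed

end

context coded_compact
begin

lemma small_oscillation:
  fixes h :: "'e \<Rightarrow> real"
  assumes h: "continuous_on K h" and "0 < e"
  shows "\<exists>N. \<forall>n\<ge>N. \<forall>x\<in>K. \<forall>y\<in>K. code n x = code n y \<longrightarrow> \<bar>h x - h y\<bar> \<le> e"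
proof -
  obtain d where d: "0 < d" "\<And>x y. x \<in> K \<Longrightarrow> y \<in> K \<Longrightarrow> dist x y < d \<Longrightarrow> dist (h x) (h y) < e"
    using compact_uniformly_continuous[OF h compact_K] \<open>0 < e\<close>
    unfolding uniformly_continuous_on_def by (metis dist_commute)
  obtain N where "\<forall>n\<ge>N. \<forall>x\<in>K. \<forall>y\<in>K. code n x = code n y \<longrightarrow> dist x y < d"
    using code_separates[OF d(1)] by blast
  then show ?thesis
    using d(2) by (intro exI[of _ N]) (force simp: dist_real_def intro: less_imp_le)
qed

text \<open>
  Every \<open>a\<close> is sent to a measure whose integrals are the limits of the Riemann sums of \<open>a\<close>, with the
  error bound \<open>close\<close>. The limits are uniform in \<open>a\<close>, so the assignment is continuous. If \<open>a\<close> is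
  already the set function of a Borel measure, that measure is chosen; this makes the assignment
  surjective at once.
\<close>

lemma compact_subprobs: "compact_space (subprobs_top K)"
proof -
  define close where "close a \<nu> \<longleftrightarrow> (\<forall>h n e. continuous_on K h \<and> 0 \<le> e \<and>
      (\<forall>x\<in>K. \<forall>y\<in>K. code n x = code n y \<longrightarrow> \<bar>h x - h y\<bar> \<le> e) \<longrightarrow>
      \<bar>approx h n a - (\<integral>x. h x \<partial>\<nu>)\<bar> \<le> e)" for a and \<nu> :: "'e measure"
  have closeD: "\<bar>approx h n a - (\<integral>x. h x \<partial>\<nu>)\<bar> \<le> e"
    if "close a \<nu>" "continuous_on K h" "0 \<le> e"
      "\<forall>x\<in>K. \<forall>y\<in>K. code n x = code n y \<longrightarrow> \<bar>h x - h y\<bar> \<le> e" for a \<nu> h n e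
    using that unfolding close_def by blast
  have inj: "\<nu> = \<nu>'" if "\<nu> \<in> subprobs_on K" "\<nu>' \<in> subprobs_on K" "measure \<nu> = measure \<nu>'" for \<nu> \<nu>'
  proof -
    interpret \<nu>: subprob_space \<nu> using subprobs_onD(1)[OF that(1)] .
    interpret \<nu>': subprob_space \<nu>' using subprobs_onD(1)[OF that(2)] .
    show ?thesis
      using that subprobs_onD(2)[OF that(1)] subprobs_onD(2)[OF that(2)]
      by (intro measure_eqI) (auto simp: \<nu>.emeasure_eq_measure \<nu>'.emeasure_eq_measure)
  qed
  have "\<exists>\<nu>. \<nu> \<in> subprobs_on K \<and> close a \<nu> \<and> (\<forall>\<nu>'\<in>subprobs_on K. measure \<nu>' = a \<longrightarrow> \<nu>' = \<nu>)"
    if a: "a \<in> additive_subprobs K" for a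
  proof (cases "\<exists>\<nu>\<in>subprobs_on K. measure \<nu> = a")
    case True
    then obtain \<nu> where \<nu>: "\<nu> \<in> subprobs_on K" "measure \<nu> = a" by blast
    have "close a \<nu>"
      unfolding close_def \<nu>(2)[symmetric] by (intro allI impI approx_close_integral \<nu>) auto
    then show ?thesis using \<nu> inj by metis
  next
    case False
    interpret coded_additive K B a by unfold_locales (rule a)
    have "close a representing_measure"
      unfolding close_def by (intro allI impI approx_close_representing) auto
    then show ?thesis using representing_measure_in False by blast
  qed
  then obtain d where d: "\<And>a. a \<in> additive_subprobs K \<Longrightarrow> d a \<in> subprobs_on K \<and> close a (d a) \<and>
      (\<forall>\<nu>'\<in>subprobs_on K. measure \<nu>' = a \<longrightarrow> \<nu>' = d a)"
    by metis
  have cont: "continuous_map (top_of_set (additive_subprobs K)) (subprobs_top K) d"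
    unfolding subprobs_top_def
  proof (rule continuous_map_into_weak_topology)
    fix h :: "'e \<Rightarrow> real" assume "continuous_map (top_of_set K) euclideanreal h"
    then have h: "continuous_on K h" by simp
    have cont_approx: "continuous_on (additive_subprobs K) (approx h n)" for n
      unfolding approx_def
      by (intro continuous_intros continuous_on_subset[OF continuous_on_product_coordinates]) auto
    have "uniform_limit (additive_subprobs K) (approx h) (\<lambda>a. \<integral>x. h x \<partial>d a) sequentially"
    proof (rule uniform_limitI)
      fix e :: real assume "0 < e"
      then obtain N where N: "\<forall>n\<ge>N. \<forall>x\<in>K. \<forall>y\<in>K. code n x = code n y \<longrightarrow> \<bar>h x - h y\<bar> \<le> e / 2"
        using small_oscillation[OF h, of "e / 2"] by auto
      have "\<bar>approx h n a - (\<integral>x. h x \<partial>d a)\<bar> \<le> e / 2" if "n \<ge> N" "a \<in> additive_subprobs K" for n a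
        using d[OF that(2)] N that(1) \<open>0 < e\<close> by (intro closeD h) auto
      then show "\<forall>\<^sub>F n in sequentially. \<forall>a\<in>additive_subprobs K. dist (approx h n a) (\<integral>x. h x \<partial>d a) < e"
        using \<open>0 < e\<close> by (intro eventually_sequentiallyI[of N]) (fastforce simp: dist_real_def)
    qed
    from uniform_limit_theorem[OF always_eventually[OF allI[OF cont_approx]] this]
    have "continuous_on (additive_subprobs K) (\<lambda>a. \<integral>x. h x \<partial>d a)" by simp
    then show "continuous_map (top_of_set (additive_subprobs K)) euclideanreal (\<lambda>a. \<integral>x. h x \<partial>d a)"
      by simp
  qed (use d in auto)
  have "d ` additive_subprobs K = subprobs_on K"
  proof
    show "subprobs_on K \<subseteq> d ` additive_subprobs K"
    proof
      fix \<nu> :: "'e measure" assume \<nu>: "\<nu> \<in> subprobs_on K"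
      interpret subprob_space \<nu> using subprobs_onD(1)[OF \<nu>] .
      have "measure \<nu> \<in> additive_subprobs K"
        using subprob_measure_le_1 subprobs_onD(2)[OF \<nu>]
        by (auto simp: additive_subprobs_def finite_measure_Union)
      then show "\<nu> \<in> d ` additive_subprobs K" using d \<nu> by blast
    qed
  qed (use d in auto)
  moreover have "compactin (subprobs_top K) (d ` additive_subprobs K)"
    using compact_additive_subprobs
    by (intro image_compactin[OF _ cont]) (simp add: compactin_subtopology)
  ultimately show ?thesis by (simp add: compact_space_def subprobs_top_def)
qed

end

theorem compact_space_subprobs_top:
  fixes K :: "'e::metric_space set"
  assumes "compact K" "K \<noteq> {}"
  shows "compact_space (subprobs_top K)"
proof -
  obtain B :: "nat \<Rightarrow> 'e set" where "\<And>i. open (B i)"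
    "\<And>\<epsilon>. 0 < \<epsilon> \<Longrightarrow> \<exists>N. \<forall>x\<in>K. \<forall>y\<in>K. (\<forall>i<N. x \<in> B i \<longleftrightarrow> y \<in> B i) \<longrightarrow> dist x y < \<epsilon>"
    using compact_separating_open_sets[OF assms(1)] by blast
  then interpret coded_compact K B using assms by unfold_locales
  show ?thesis by (rule compact_subprobs)
qed

section \<open>Joint continuity of integrals\<close>

text \<open>
  If \<open>y\<close> is close to \<open>y0\<close>, then \<open>h (x, y)\<close> is close to \<open>h (x, y0)\<close> uniformly in \<open>x\<close>, by the tube lemma
  for the compact \<open>K\<close>. This controls the change of the integrand for every measure of mass at most 1;
  the change of the measure for the fixed integrand \<open>h (\<cdot>, y0)\<close> is controlled by weak convergence.
\<close>

lemma continuous_map_integral_joint: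
  fixes h :: "'e::metric_space \<times> 'b \<Rightarrow> real"
  assumes K: "compact K"
    and h: "continuous_map (prod_topology (top_of_set K) Y) euclideanreal h"
  shows "continuous_map (prod_topology Y (subprobs_top K)) euclideanreal
    (\<lambda>(y, \<nu>). \<integral>x. h (x, y) \<partial>\<nu>)"
proof -
  have slice: "continuous_on K (\<lambda>x. h (x, y))" if "y \<in> topspace Y" for y
  proof -
    have "continuous_map (top_of_set K) euclideanreal (h \<circ> (\<lambda>x. (x, y)))"
      by (rule continuous_map_compose[OF _ h]) (use that in \<open>simp add: continuous_map_pairwise comp_def\<close>)
    then show ?thesis by (simp add: comp_def)
  qed
  have "\<exists>N. openin (prod_topology Y (subprobs_top K)) N \<and> (y0, \<nu>0) \<in> N \<and>
      (\<forall>(y, \<nu>)\<in>N. \<bar>(\<integral>x. h (x, y0) \<partial>\<nu>0) - (\<integral>x. h (x, y) \<partial>\<nu>)\<bar> < \<epsilon>)"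
    if y0: "y0 \<in> topspace Y" and \<nu>0: "\<nu>0 \<in> subprobs_on K" and \<epsilon>: "0 < \<epsilon>" for y0 \<nu>0 \<epsilon>
  proof -
    define h0 where "h0 x = h (x, y0)" for x
    have h0: "continuous_on K h0" unfolding h0_def by (rule slice[OF y0])
    define G where "G = {p \<in> topspace (prod_topology (top_of_set K) Y). h p - h0 (fst p) \<in> {-\<epsilon>/2<..<\<epsilon>/2}}"
    have "continuous_map (prod_topology (top_of_set K) Y) euclideanreal (\<lambda>p. h p - h0 (fst p))"
      using continuous_map_compose[OF continuous_map_fst, of "top_of_set K" euclideanreal h0 Y] h0
      by (intro continuous_map_diff h) (simp add: comp_def)
    then have "openin (prod_topology (top_of_set K) Y) G"
      unfolding G_def by (rule openin_continuous_map_preimage) (simp add: open_greaterThanLessThan)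
    moreover have "K \<times> {y0} \<subseteq> G" using y0 \<epsilon> by (auto simp: G_def h0_def)
    ultimately obtain A V where AV: "openin Y V" "K \<subseteq> A" "y0 \<in> V" "A \<times> V \<subseteq> G"
      using tube_lemma_left[of "top_of_set K" Y G K y0] y0 K by (auto simp: compactin_subtopology)
    define Q where "Q = {\<nu> \<in> topspace (subprobs_top K). (\<integral>x. h0 x \<partial>\<nu>) \<in> ball (\<integral>x. h0 x \<partial>\<nu>0) (\<epsilon>/2)}"
    have "continuous_map (subprobs_top K) euclideanreal (\<lambda>\<nu>. \<integral>x. h0 x \<partial>\<nu>)"
      unfolding subprobs_top_def using h0 compact_imp_bounded[OF compact_continuous_image[OF h0 K]]
      by (intro continuous_map_integral_weak_topology) auto
    then have "openin (subprobs_top K) Q"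
      unfolding Q_def by (rule openin_continuous_map_preimage) simp
    then have "openin (prod_topology Y (subprobs_top K)) (V \<times> Q)"
      using AV by (simp add: openin_prod_Times_iff)
    moreover have "(y0, \<nu>0) \<in> V \<times> Q"
      using AV \<nu>0 \<epsilon> by (simp add: Q_def subprobs_top_def)
    moreover have "\<bar>(\<integral>x. h (x, y0) \<partial>\<nu>0) - (\<integral>x. h (x, y) \<partial>\<nu>)\<bar> < \<epsilon>" if "y \<in> V" "\<nu> \<in> Q" for y \<nu>
    proof -
      have \<nu>: "\<nu> \<in> subprobs_on K" "\<bar>(\<integral>x. h0 x \<partial>\<nu>0) - (\<integral>x. h0 x \<partial>\<nu>)\<bar> < \<epsilon>/2"
        using that by (auto simp: Q_def subprobs_top_def dist_real_def)
      have y: "y \<in> topspace Y" using that AV(1) openin_subset by blast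
      have "\<bar>(\<integral>x. h0 x \<partial>\<nu>) - (\<integral>x. h (x, y) \<partial>\<nu>)\<bar> \<le> \<epsilon>/2"
      proof (rule subprobs_on_integral_close[OF \<nu>(1)])
        fix x assume "x \<in> K"
        then have "(x, y) \<in> G" using AV that by blast
        then have "h (x, y) - h0 x \<in> {-\<epsilon>/2<..<\<epsilon>/2}" by (simp add: G_def)
        then show "\<bar>h0 x - h (x, y)\<bar> \<le> \<epsilon>/2" unfolding greaterThanLessThan_iff by linarith
      qed (use \<epsilon> subprobs_on_integrable_continuous[OF \<nu>(1) K] h0 slice[OF y] in auto)
      with \<nu>(2) show ?thesis unfolding h0_def[symmetric] by linarith
    qed
    ultimately show ?thesis by (intro exI[of _ "V \<times> Q"]) auto
  qed
  then have "continuous_map (prod_topology Y (subprobs_top K)) Met_TC.mtopology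
    (\<lambda>(y, \<nu>). \<integral>x. h (x, y) \<partial>\<nu>)"
    unfolding Met_TC.continuous_map_to_metric
    by (fastforce simp: subprobs_top_def dist_real_def)
  then show ?thesis by simp
qed

section \<open>Mixtures of measures and of measure flows\<close>

text \<open>
  The convex combination \<open>\<Sum>i<n. \<theta> i * \<nu> i\<close>, obtained by drawing an index with law \<open>\<theta>\<close> first.
\<close>

definition mixture :: "nat \<Rightarrow> (nat \<Rightarrow> real) \<Rightarrow> (nat \<Rightarrow> 'a measure) \<Rightarrow> 'a measure" where
  "mixture n \<theta> \<nu> = density (count_space {..<n}) (\<lambda>i. ennreal (\<theta> i)) \<bind> \<nu>"

lemma
  fixes h :: "'e::metric_space \<Rightarrow> real"
  assumes \<theta>: "\<theta> \<in> prob_simplex n" and \<nu>: "\<And>i. i < n \<Longrightarrow> \<nu> i \<in> subprobs_on K"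
  shows mixture_in_subprobs: "mixture n \<theta> \<nu> \<in> subprobs_on K"
    and integral_mixture: "compact K \<Longrightarrow> continuous_on K h \<Longrightarrow>
      (\<integral>x. h x \<partial>mixture n \<theta> \<nu>) = (\<Sum>i<n. \<theta> i * (\<integral>x. h x \<partial>\<nu> i))"
proof -
  let ?N = "density (count_space {..<n}) (\<lambda>i. ennreal (\<theta> i))"
  have n: "n > 0" using \<theta> by (cases n) (auto simp: prob_simplex_def)
  have "emeasure ?N (space ?N) = (\<Sum>i<n. ennreal (\<theta> i))"
    by (simp add: emeasure_density nn_integral_count_space_finite)
  also have "\<dots> = 1" using \<theta> by (simp add: prob_simplex_def sum_ennreal)
  finally have N: "prob_space ?N" by (rule prob_spaceI)
  have N_sub: "subprob_space ?N" using N by (rule prob_space_imp_subprob_space)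
  have meas: "\<nu> \<in> measurable ?N (subprob_algebra (borel_on K))"
    using \<nu> by (auto simp: subprobs_on_def measurable_def)
  have "sets (mixture n \<theta> \<nu>) = sets (borel_on K)"
    unfolding mixture_def using subprobs_onD(2)[OF \<nu>] n by (intro sets_bind) auto
  then show "mixture n \<theta> \<nu> \<in> subprobs_on K"
    using subprob_space_bind[OF N_sub meas]
    by (simp add: subprobs_on_def space_subprob_algebra mixture_def)
  assume K: "compact K" and h: "continuous_on K h"
  obtain b where b: "\<And>x. x \<in> K \<Longrightarrow> \<bar>h x\<bar> \<le> b"
    using continuous_on_compact_bounded[OF K h] by blast
  have "(\<integral>x. h x \<partial>mixture n \<theta> \<nu>) = (\<integral>i. (\<integral>x. h x \<partial>\<nu> i) \<partial>?N)"
    unfolding mixture_def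
  proof (rule integral_bind[OF measurable_borel_on_continuous[OF h] _ meas, where B = b and B' = 1])
    show "finite_measure ?N" using N by (simp add: prob_space_def)
    show "AE i in ?N. emeasure (\<nu> i) (space (\<nu> i)) \<le> ennreal 1"
      using subprobs_onD(1)[OF \<nu>] subprob_space.emeasure_space_le_1 by (intro AE_I2) auto
  qed (use b in auto)
  also have "\<dots> = (\<integral>i. \<theta> i * (\<integral>x. h x \<partial>\<nu> i) \<partial>count_space {..<n})"
    using \<theta> by (subst integral_density) (auto simp: prob_simplex_def)
  also have "\<dots> = (\<Sum>i<n. \<theta> i * (\<integral>x. h x \<partial>\<nu> i))"
    by (simp add: lebesgue_integral_count_space_finite)
  finally show "(\<integral>x. h x \<partial>mixture n \<theta> \<nu>) = (\<Sum>i<n. \<theta> i * (\<integral>x. h x \<partial>\<nu> i))" .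
qed

definition flow_top :: "nat set \<Rightarrow> (nat \<Rightarrow> mat01 set) \<Rightarrow> 'e::metric_space set \<Rightarrow> 'e measure_flow topology"
  where "flow_top I \<Omega> K = product_topology (\<lambda>t. product_topology (\<lambda>u. subprobs_top K) (\<Omega> t)) I"

lemma topspace_subprobs_top [simp]: "topspace (subprobs_top K) = subprobs_on K"
  by (simp add: subprobs_top_def)

lemma topspace_flow_top: "topspace (flow_top I \<Omega> K) = (\<Pi>\<^sub>E t\<in>I. \<Omega> t \<rightarrow>\<^sub>E subprobs_on K)"
  by (simp add: flow_top_def)

lemma compact_space_flow_top: "compact K \<Longrightarrow> K \<noteq> {} \<Longrightarrow> compact_space (flow_top I \<Omega> K)"
  unfolding flow_top_def by (simp add: compact_space_product_topology compact_space_subprobs_top)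

lemma continuous_map_flow_component:
  assumes "continuous_map Y (flow_top I \<Omega> K) q" "t \<in> I" "u \<in> \<Omega> t"
  shows "continuous_map Y (subprobs_top K) (\<lambda>y. q y t u)"
  using assms unfolding flow_top_def continuous_map_componentwise by auto

text \<open>
  The linear functionals of a flow out of which both the balance constraints and the reward are built.
\<close>

definition flow_integral :: "nat set \<Rightarrow> (nat \<Rightarrow> mat01 set) \<Rightarrow> (nat \<Rightarrow> mat01 \<Rightarrow> real) \<Rightarrow>
    (nat \<Rightarrow> mat01 \<Rightarrow> 'e \<Rightarrow> real) \<Rightarrow> 'e measure_flow \<Rightarrow> real" where
  "flow_integral I \<Omega> p \<alpha> \<nu> = (\<Sum>t\<in>I. \<Sum>u\<in>\<Omega> t. p t u * (\<integral>x. \<alpha> t u x \<partial>\<nu> t u))"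

lemma continuous_map_flow_integral:
  assumes K: "compact K" and fin: "finite I" "\<And>t. t \<in> I \<Longrightarrow> finite (\<Omega> t)"
    and q: "continuous_map Y (flow_top I \<Omega> K) q"
    and \<alpha>: "\<And>t u. t \<in> I \<Longrightarrow> u \<in> \<Omega> t \<Longrightarrow>
      continuous_map (prod_topology (top_of_set K) Y) euclideanreal (\<lambda>(x, y). \<alpha> y t u x)"
  shows "continuous_map Y euclideanreal (\<lambda>y. flow_integral I \<Omega> p (\<alpha> y) (q y))"
  unfolding flow_integral_def
proof (intro continuous_map_sum continuous_map_real_mult fin)
  fix t u assume t: "t \<in> I" and u: "u \<in> \<Omega> t"
  have "continuous_map Y euclideanreal (\<lambda>y. \<integral>x. (\<lambda>(x, y). \<alpha> y t u x) (x, y) \<partial>q y t u)"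
    by (rule continuous_map_pair_compose[OF continuous_map_id[unfolded id_def] continuous_map_flow_component[OF q t u]
          continuous_map_integral_joint[OF K \<alpha>[OF t u]]])
  then show "continuous_map Y euclideanreal (\<lambda>y. \<integral>x. \<alpha> y t u x \<partial>q y t u)" by simp
qed auto

definition mixture_flow :: "nat set \<Rightarrow> (nat \<Rightarrow> mat01 set) \<Rightarrow> nat \<Rightarrow> (nat \<Rightarrow> real) \<Rightarrow>
    (nat \<Rightarrow> 'e measure_flow) \<Rightarrow> 'e measure_flow" where
  "mixture_flow I \<Omega> n \<theta> \<nu> = (\<lambda>t\<in>I. \<lambda>u\<in>\<Omega> t. mixture n \<theta> (\<lambda>i. \<nu> i t u))"

lemma flow_component_in:
  "\<nu> \<in> topspace (flow_top I \<Omega> K) \<Longrightarrow> t \<in> I \<Longrightarrow> u \<in> \<Omega> t \<Longrightarrow> \<nu> t u \<in> subprobs_on K"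
  unfolding topspace_flow_top by (drule (1) PiE_mem) (drule (1) PiE_mem)

lemma flow_integral_mixture:
  assumes \<theta>: "\<theta> \<in> prob_simplex n" and \<nu>: "\<And>i. i < n \<Longrightarrow> \<nu> i \<in> topspace (flow_top I \<Omega> K)"
    and K: "compact K"
    and \<alpha>: "\<And>t u. t \<in> I \<Longrightarrow> u \<in> \<Omega> t \<Longrightarrow> continuous_on K (\<alpha> t u)"
  shows "flow_integral I \<Omega> p \<alpha> (mixture_flow I \<Omega> n \<theta> \<nu>)
    = (\<Sum>i<n. \<theta> i * flow_integral I \<Omega> p \<alpha> (\<nu> i))"
proof -
  have "flow_integral I \<Omega> p \<alpha> (mixture_flow I \<Omega> n \<theta> \<nu>)
    = (\<Sum>t\<in>I. \<Sum>u\<in>\<Omega> t. p t u * (\<Sum>i<n. \<theta> i * (\<integral>x. \<alpha> t u x \<partial>\<nu> i t u)))"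
    unfolding flow_integral_def mixture_flow_def
    using flow_component_in[OF \<nu>]
    by (intro sum.cong refl) (simp add: integral_mixture[OF \<theta> _ K \<alpha>])
  also have "\<dots> = (\<Sum>t\<in>I. \<Sum>i<n. \<Sum>u\<in>\<Omega> t. \<theta> i * (p t u * (\<integral>x. \<alpha> t u x \<partial>\<nu> i t u)))"
    by (subst sum.swap) (simp add: sum_distrib_left mult.left_commute)
  also have "\<dots> = (\<Sum>i<n. \<theta> i * flow_integral I \<Omega> p \<alpha> (\<nu> i))"
    by (subst sum.swap) (simp add: flow_integral_def sum_distrib_left)
  finally show ?thesis .
qed

lemma continuous_map_mixture_flow:
  assumes \<nu>: "\<And>i. i < n \<Longrightarrow> \<nu> i \<in> topspace (flow_top I \<Omega> K)" and K: "compact K"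
  shows "continuous_map (top_of_set (prob_simplex n)) (flow_top I \<Omega> K)
    (\<lambda>\<theta>. mixture_flow I \<Omega> n \<theta> \<nu>)"
proof -
  have mix: "continuous_map (top_of_set (prob_simplex n)) (subprobs_top K)
      (\<lambda>\<theta>. mixture n \<theta> (\<lambda>i. \<nu> i t u))" if t: "t \<in> I" "u \<in> \<Omega> t" for t u
    unfolding subprobs_top_def
  proof (rule continuous_map_into_weak_topology)
    note \<nu>' = flow_component_in[OF \<nu> t]
    show "mixture n \<theta> (\<lambda>i. \<nu> i t u) \<in> subprobs_on K" if "\<theta> \<in> topspace (top_of_set (prob_simplex n))" for \<theta>
      using that by (intro mixture_in_subprobs \<nu>') auto
    fix h :: "'a \<Rightarrow> real" assume "continuous_map (top_of_set K) euclideanreal h"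
    then have h: "continuous_on K h" by simp
    have "continuous_on (prob_simplex n) (\<lambda>\<theta>. \<Sum>i<n. \<theta> i * (\<integral>x. h x \<partial>\<nu> i t u))"
      by (intro continuous_intros continuous_on_subset[OF continuous_on_product_coordinates]) auto
    then have "continuous_on (prob_simplex n) (\<lambda>\<theta>. \<integral>x. h x \<partial>mixture n \<theta> (\<lambda>i. \<nu> i t u))"
      by (rule continuous_on_eq) (simp add: integral_mixture[OF _ \<nu>' K h])
    then show "continuous_map (top_of_set (prob_simplex n)) euclideanreal
        (\<lambda>\<theta>. \<integral>x. h x \<partial>mixture n \<theta> (\<lambda>i. \<nu> i t u))" by simp
  qed
  show ?thesis
    unfolding flow_top_def mixture_flow_def continuous_map_componentwise
    using mix by (auto simp: restrict_apply')
qed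

section \<open>Continuity of the generator\<close>

lemma measurable_state_continuous:
  assumes W: "finite W" and h: "continuous_map (state_top E W) euclideanreal h"
  shows "h \<in> borel_measurable (state_measure E W)"
proof -
  have "(\<lambda>(u, x). h (x, u)) \<in> borel_measurable (count_space W \<Otimes>\<^sub>M borel_on E)"
  proof (rule measurable_pair_measure_countable1)
    fix u assume u: "u \<in> W"
    have "continuous_map (top_of_set E) euclideanreal (h \<circ> (\<lambda>x. (x, u)))"
      by (rule continuous_map_compose[OF _ h])
        (use u in \<open>simp add: state_top_def continuous_map_pairwise comp_def\<close>)
    then show "(\<lambda>x. case (u, x) of (u, x) \<Rightarrow> h (x, u)) \<in> borel_measurable (borel_on E)"
      by (intro measurable_borel_on_continuous) (simp add: comp_def)
  qed (use W in \<open>simp add: countable_finite\<close>)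
  from measurable_pair_swap[OF this] show ?thesis
    by (simp add: state_measure_def case_prod_unfold)
qed

lemma bounded_state_continuous:
  assumes "compact E" "finite W" and h: "continuous_map (state_top E W) euclideanreal h"
  shows "bounded (h ` topspace (state_top E W))"
proof -
  have "compact_space (state_top E W)"
    using assms(1,2) unfolding state_top_def
    by (simp add: compact_space_prod_topology compact_space_subtopology compact_space_discrete_topology)
  then have "compactin euclideanreal (h ` topspace (state_top E W))"
    unfolding compact_space_def by (rule image_compactin[OF _ h])
  then show ?thesis by (simp add: compact_imp_bounded)
qed

text \<open>
  The first term of the generator is the integral of a bounded continuous function against the kernel,
  hence continuous in the starting point by weak continuity of the kernel; subtracting
  \<open>\<phi> (t, x, u)\<close> under the integral is subtracting it outside, as the kernel has mass 1.
\<close>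

lemma continuous_on_generator:
  fixes E :: "'e::metric_space set"
  assumes E: "compact E" and W: "finite W" and u: "u \<in> W" and t: "t < T"
    and \<pi>: "continuous_map (state_top E W) (state_probs_top E W) (\<pi> (t + 1))"
    and \<phi>: "\<phi> \<in> test_functions T E W"
  shows "continuous_on E (\<lambda>x. generator \<pi> \<phi> (t, x, u))"
proof -
  have \<phi>_cont: "continuous_map (prod_topology (discrete_topology {0..T}) (state_top E W)) euclideanreal \<phi>"
    using \<phi> by (simp add: test_functions_def)
  define \<psi> where "\<psi> s = \<phi> (t + 1, s)" for s
  have \<psi>: "continuous_map (state_top E W) euclideanreal \<psi>"
  proof -
    have "continuous_map (state_top E W) euclideanreal (\<phi> \<circ> (\<lambda>s. (t + 1, s)))"
      by (rule continuous_map_compose[OF _ \<phi>_cont]) (use t in \<open>simp add: continuous_map_pairwise comp_def\<close>)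
    then show ?thesis by (simp add: \<psi>_def[abs_def] comp_def)
  qed
  have \<psi>_bounded: "bounded (\<psi> ` topspace (state_top E W))"
    by (rule bounded_state_continuous[OF E W \<psi>])
  have space: "topspace (state_top E W) = space (state_measure E W)"
    by (simp add: state_top_def state_measure_def space_pair_measure)
  have xu: "continuous_map (top_of_set E) (state_top E W) (\<lambda>x. (x, u))"
    using u by (simp add: state_top_def continuous_map_pairwise comp_def)
  have eq: "generator \<pi> \<phi> (t, x, u) = (\<integral>s. \<psi> s \<partial>\<pi> (t + 1) (x, u)) - \<phi> (t, x, u)" if x: "x \<in> E" for x
  proof -
    have "\<pi> (t + 1) (x, u) \<in> topspace (state_probs_top E W)"
      using continuous_map_image_subset_topspace[OF \<pi>] x u by (auto simp: state_top_def)
    then have k: "prob_space (\<pi> (t + 1) (x, u))" "sets (\<pi> (t + 1) (x, u)) = sets (state_measure E W)"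
      by (auto simp: state_probs_top_def space_prob_algebra)
    interpret prob_space "\<pi> (t + 1) (x, u)" by (rule k)
    obtain b where b: "\<And>s. s \<in> space (state_measure E W) \<Longrightarrow> norm (\<psi> s) \<le> b"
      using \<psi>_bounded unfolding bounded_iff space by auto
    have "\<psi> \<in> borel_measurable (\<pi> (t + 1) (x, u))"
      using measurable_state_continuous[OF W \<psi>] measurable_cong_sets[OF k(2) refl] by blast
    then have "integrable (\<pi> (t + 1) (x, u)) \<psi>"
      using b sets_eq_imp_space_eq[OF k(2)] by (intro integrable_const_bound[of _ b]) auto
    then have "(\<integral>s. \<psi> s - \<phi> (t, x, u) \<partial>\<pi> (t + 1) (x, u))
        = (\<integral>s. \<psi> s \<partial>\<pi> (t + 1) (x, u)) - (\<integral>s. \<phi> (t, x, u) \<partial>\<pi> (t + 1) (x, u))"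
      by (rule Bochner_Integration.integral_diff) (rule integrable_const)
    moreover have "(\<integral>s. \<phi> (t, x, u) \<partial>\<pi> (t + 1) (x, u)) = \<phi> (t, x, u)"
      unfolding lebesgue_integral_const prob_space by simp
    ultimately show ?thesis
      by (simp add: generator_def case_prod_unfold \<psi>_def)
  qed
  have "continuous_map (top_of_set E) euclideanreal (\<lambda>x. (\<integral>s. \<psi> s \<partial>\<pi> (t + 1) (x, u)) - \<phi> (t, x, u))"
  proof (rule continuous_map_diff)
    show "continuous_map (top_of_set E) euclideanreal (\<lambda>x. \<integral>s. \<psi> s \<partial>\<pi> (t + 1) (x, u))"
      using continuous_map_compose[OF continuous_map_compose[OF xu \<pi>]
          continuous_map_integral_weak_topology[OF \<psi> \<psi>_bounded, of "space (prob_algebra (state_measure E W))",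
            folded state_probs_top_def]]
      by (simp add: comp_def)
    have "continuous_map (top_of_set E) (prod_topology (discrete_topology {0..T}) (state_top E W))
        (\<lambda>x. (t, x, u))"
      using t xu by (simp add: continuous_map_pairwise comp_def)
    from continuous_map_compose[OF this \<phi>_cont]
    show "continuous_map (top_of_set E) euclideanreal (\<lambda>x. \<phi> (t, x, u))"
      by (simp add: comp_def)
  qed
  then have "continuous_on E (\<lambda>x. (\<integral>s. \<psi> s \<partial>\<pi> (t + 1) (x, u)) - \<phi> (t, x, u))" by simp
  then show ?thesis by (rule continuous_on_eq) (simp add: eq)
qed

lemma continuous_on_test_function:
  assumes "\<phi> \<in> test_functions T E W" "t \<le> T" "u \<in> W"
  shows "continuous_on E (\<lambda>x. \<phi> (t, x, u))"
proof -
  have "continuous_map (top_of_set E) euclideanreal (\<phi> \<circ> (\<lambda>x. (t, x, u)))"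
    by (rule continuous_map_compose[where X' = "prod_topology (discrete_topology {0..T}) (state_top E W)"])
      (use assms in \<open>auto simp: test_functions_def state_top_def continuous_map_pairwise comp_def\<close>)
  then show ?thesis by (simp add: comp_def)
qed

section \<open>The initial law\<close>

lemma null_measure_in_subprobs: "K \<noteq> {} \<Longrightarrow> null_measure (borel_on K) \<in> subprobs_on K"
  by (simp add: subprobs_on_def space_subprob_algebra subprob_space_null_measure)

text \<open>
  The initial state lies in \<open>D\<close> almost surely, also conditionally on an event of positive probability.
  Hence restricting the integral to \<open>D\<close> does not change it, which is what makes immediate stopping
  admissible.
\<close>

lemma initial_law_integral:
  fixes E D :: "'e::metric_space set"
  assumes space: "complete_filtered_prob_space M T F"
    and D: "D \<subseteq> E" "compact D"
    and X: "X 0 \<in> F 0 \<rightarrow>\<^sub>M borel_on E" and A1: "AE \<omega> in M. X 0 \<omega> \<in> D"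
    and u: "hist_prob M U 0 u > 0"
  shows "initial_law M E X U u \<in> subprobs_on E"
    and "h \<in> borel_measurable (borel_on E) \<Longrightarrow>
      (LINT x:D|initial_law M E X U u. h x) = (\<integral>x. h x \<partial>initial_law M E X U u)"
proof -
  interpret prob_space M using space by (simp add: complete_filtered_prob_space_def)
  have "subalgebra M (F 0)" using space by (simp add: complete_filtered_prob_space_def)
  then have X0: "X 0 \<in> M \<rightarrow>\<^sub>M borel_on E" using X by (rule measurable_from_subalg)
  define A where "A = {\<omega> \<in> space M. U 0 \<omega> = u}"
  have A: "measure M A > 0" using u by (simp add: hist_prob_def A_def)
  then have A_sets: "A \<in> sets M" using measure_notin_sets by force
  have X0': "X 0 \<in> uniform_measure M A \<rightarrow>\<^sub>M borel_on E" using X0 by simp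
  have "prob_space (uniform_measure M A)"
    using A by (intro prob_space_uniform_measure) (auto simp: emeasure_eq_measure)
  then have prob: "prob_space (initial_law M E X U u)"
    unfolding initial_law_def A_def[symmetric] by (rule prob_space.prob_space_distr) (rule X0')
  have sets: "sets (initial_law M E X U u) = sets (borel_on E)" by (simp add: initial_law_def)
  show "initial_law M E X U u \<in> subprobs_on E"
    using prob sets prob_space_imp_subprob_space by (auto simp: subprobs_on_def space_subprob_algebra)
  have D_sets: "D \<in> sets (borel_on E)"
    using D by (auto simp: borel_on_def sets_restrict_space intro!: image_eqI[of _ _ D] borel_compact)
  assume h: "h \<in> borel_measurable (borel_on E)"
  have "AE x in initial_law M E X U u. x \<in> D"
    unfolding initial_law_def A_def[symmetric]
  proof (subst AE_distr_iff[OF X0'])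
    show "{x \<in> space (borel_on E). x \<in> D} \<in> sets (borel_on E)"
      using D_sets D by (simp add: Int_absorb1 Collect_conj_eq)
    show "AE \<omega> in uniform_measure M A. X 0 \<omega> \<in> D"
      using A1 by (intro AE_uniform_measureI[OF A_sets]) auto
  qed
  then show "(LINT x:D|initial_law M E X U u. h x) = (\<integral>x. h x \<partial>initial_law M E X U u)"
    unfolding set_lebesgue_integral_def using h D_sets measurable_cong_sets[OF sets refl]
    by (intro integral_cong_AE) (auto simp: sets)
qed

section \<open>Continuous maps on products\<close>

lemma continuous_map_of_fst:
  assumes "continuous_on K a"
  shows "continuous_map (prod_topology (top_of_set K) Y) euclideanreal (\<lambda>(x, y). a x)"
  using continuous_map_compose[OF continuous_map_fst, of "top_of_set K" euclideanreal a Y] assms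
  by (simp add: comp_def case_prod_unfold)

lemma continuous_map_fix_middle:
  assumes "continuous_map (prod_topology A (prod_topology (discrete_topology W) B)) C h" "u \<in> W"
  shows "continuous_map (prod_topology A B) C (\<lambda>(x, y). h (x, u, y))"
proof -
  have "continuous_map (prod_topology A B) (prod_topology A (prod_topology (discrete_topology W) B))
      (\<lambda>p. (fst p, u, snd p))"
    using assms(2) by (simp add: continuous_map_pairwise comp_def continuous_map_fst continuous_map_snd)
  from continuous_map_compose[OF this assms(1)] show ?thesis
    by (simp add: comp_def case_prod_unfold)
qed

lemma continuous_map_second_compose:
  assumes "continuous_map (prod_topology A B) C (\<lambda>(x, y). h x y)" "continuous_map Y B q"
  shows "continuous_map (prod_topology A Y) C (\<lambda>(x, y). h x (q y))"
  using continuous_map_pair_compose[OF continuous_map_fst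
      continuous_map_compose[OF continuous_map_snd assms(2)] assms(1)]
  by (simp add: comp_def case_prod_unfold)

lemma continuous_map_slice:
  assumes "continuous_map (prod_topology A B) C (\<lambda>(x, y). h x y)" "y \<in> topspace B"
  shows "continuous_map A C (\<lambda>x. h x y)"
  by (rule continuous_map_pair_compose[OF _ _ assms(1)]) (use assms(2) in auto)

section \<open>Existence of an equilibrium\<close>

theorem theorem2p13:
  fixes T :: nat
    and E D :: "'e::metric_space set"
    and H :: "'z set" and z :: "nat \<Rightarrow> 'z"
    and M :: "'w measure" and F :: "nat \<Rightarrow> 'w measure"
    and X :: "nat \<Rightarrow> 'w \<Rightarrow> 'e" and Z :: "nat \<Rightarrow> 'w \<Rightarrow> 'z"
    and W :: "mat01 set" and U :: "nat \<Rightarrow> 'w \<Rightarrow> mat01"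
    and \<pi> :: "nat \<Rightarrow> 'e \<times> mat01 \<Rightarrow> ('e \<times> mat01) measure"
    and f g :: "nat \<Rightarrow> 'e \<times> mat01 \<times> 'e measure \<Rightarrow> real"
  assumes T: "T \<ge> 1"
    and E: "compact E" "E \<noteq> {}"
    and D: "D \<subseteq> E" "compact D" "D \<noteq> {}"
    and H: "finite H" "H \<noteq> {}" "bij_betw z {1..card H} H"
    and space: "complete_filtered_prob_space M T F"
    and X: "\<And>t. t \<in> {0..T} \<Longrightarrow> X t \<in> F t \<rightarrow>\<^sub>M borel_on E"
    and Z: "\<And>t. t \<in> {0..T} \<Longrightarrow> Z t \<in> F t \<rightarrow>\<^sub>M count_space H"
    and W: "W = matrices01 T (card H)"
    and U: "U = noise_matrix T (card H) z Z"
    and A1: "AE \<omega> in M. X 0 \<omega> \<in> D"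
    and A2_markov:
      "markov_chain_with_kernels M T F (state_measure E W) (\<lambda>t \<omega>. (X t \<omega>, U t \<omega>)) \<pi>"
    and A2_noise:
      "\<And>t x y u u'. t \<in> {1..T} \<Longrightarrow> x \<in> E \<Longrightarrow> y \<in> E \<Longrightarrow> u \<in> W \<Longrightarrow> u' \<in> W \<Longrightarrow>
         measure (\<pi> t (x, u)) (E \<times> {u'}) = measure (\<pi> t (y, u)) (E \<times> {u'})"
    and A3: "\<And>t. t \<in> {1..T} \<Longrightarrow>
         continuous_map (state_top E W) (state_probs_top E W) (\<pi> t)"
    and A4_f: "\<And>t. t \<in> {0..<T} \<Longrightarrow>
         continuous_map
           (prod_topology (top_of_set D) (prod_topology (discrete_topology W) (subprobs_top D)))
           euclideanreal (f t)"
    and A4_g: "\<And>t. t \<in> {0..T} \<Longrightarrow>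
         continuous_map
           (prod_topology (top_of_set E) (prod_topology (discrete_topology W) (subprobs_top E)))
           euclideanreal (g t)"
  shows "\<exists>eq \<in> LP_constraint_set M T E D W X U \<pi>.
           \<forall>\<mu>m \<in> LP_constraint_set M T E D W X U \<pi>.
             reward M T W U f g eq \<mu>m \<le> reward M T W U f g eq eq"
proof -
  define \<Omega> where "\<Omega> = hist_supp M W U"
  define p where "p = hist_prob M U"
  define R where "R = LP_constraint_set M T E D W X U \<pi>"
  define \<Gamma> where "\<Gamma> = reward M T W U f g"
  define c where "c \<phi> = (\<Sum>u\<in>\<Omega> 0. p 0 u * (LINT x:D|initial_law M E X U u. \<phi> (0, x, u)))" for \<phi> :: "nat \<times> 'e \<times> mat01 \<Rightarrow> real"
  have finW: "finite W" unfolding W matrices01_def by (intro finite_PiE) auto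
  have \<Omega>W: "\<Omega> t \<subseteq> W" for t by (auto simp: \<Omega>_def hist_supp_def)
  then have fin\<Omega>: "finite (\<Omega> t)" for t using finW finite_subset by blast
  let ?SE = "flow_top {0..T} \<Omega> E" and ?SD = "flow_top {0..<T} \<Omega> D"
  let ?S = "prod_topology ?SE ?SD"
  have \<pi>: "continuous_map (state_top E W) (state_probs_top E W) (\<pi> (t + 1))" if "t < T" for t
    using A3 that by simp
  have gen: "continuous_on D (\<lambda>x. generator \<pi> \<phi> (t, x, u))"
    if "\<phi> \<in> test_functions T E W" "t \<in> {0..<T}" "u \<in> \<Omega> t" for \<phi> t u
  proof (rule continuous_on_subset[OF _ D(1)])
    have "u \<in> W" "t < T" using that \<Omega>W by auto
    then show "continuous_on E (\<lambda>x. generator \<pi> \<phi> (t, x, u))"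
      using continuous_on_generator[OF E(1) finW _ _ _ that(1)] \<pi> by blast
  qed
  have test: "continuous_on E (\<lambda>x. \<phi> (t, x, u))"
    if "\<phi> \<in> test_functions T E W" "t \<in> {0..T}" "u \<in> \<Omega> t" for \<phi> t u
    using continuous_on_test_function[OF that(1)] that \<Omega>W by auto
  \<comment> \<open>The constraint with the generator term moved to the left, so that the right-hand side does not
    depend on the flows.\<close>
  define bal where "bal \<phi> = (\<lambda>(\<mu>, m). flow_integral {0..T} \<Omega> p (\<lambda>t u x. \<phi> (t, x, u)) \<mu>
    - flow_integral {0..<T} \<Omega> p (\<lambda>t u x. generator \<pi> \<phi> (t, x, u)) m)" for \<phi>
  have R_eq: "R = topspace ?S \<inter> {s. \<forall>\<phi>\<in>test_functions T E W. bal \<phi> s = c \<phi>}"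
    unfolding R_def LP_constraint_set_def bal_def c_def flow_integral_def topspace_prod_topology
      topspace_flow_top \<Omega>_def p_def
    by (auto simp: algebra_simps)
  have \<Gamma>_eq: "\<Gamma> s s' = flow_integral {0..<T} \<Omega> p (\<lambda>t u x. f t (x, u, snd s t u)) (snd s')
      + flow_integral {0..T} \<Omega> p (\<lambda>t u x. g t (x, u, fst s t u)) (fst s')" for s s'
    by (simp add: \<Gamma>_def reward_def flow_integral_def \<Omega>_def p_def case_prod_unfold)
  define XR where "XR = subtopology ?S R"
  have top_XR: "topspace XR = R" by (auto simp: XR_def R_eq)
  have bal_cont: "continuous_map ?S euclideanreal (bal \<phi>)" if \<phi>: "\<phi> \<in> test_functions T E W" for \<phi>
    unfolding bal_def case_prod_unfold
    using continuous_map_of_fst[OF test[OF \<phi>]] continuous_map_of_fst[OF gen[OF \<phi>]]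
    by (intro continuous_map_diff continuous_map_flow_integral[OF E(1) _ fin\<Omega> continuous_map_fst]
        continuous_map_flow_integral[OF D(2) _ fin\<Omega> continuous_map_snd]) auto
  have "closedin ?S R"
  proof -
    have "closedin ?S {s \<in> topspace ?S. bal \<phi> s \<in> {c \<phi>}}" if "\<phi> \<in> test_functions T E W" for \<phi>
      by (rule closedin_continuous_map_preimage[OF bal_cont[OF that]]) simp
    then have "closedin ?S C"
      if "C \<in> insert (topspace ?S) ((\<lambda>\<phi>. {s \<in> topspace ?S. bal \<phi> s \<in> {c \<phi>}}) ` test_functions T E W)"
      for C
      using that closedin_topspace by blast
    then have "closedin ?S (\<Inter> (insert (topspace ?S)
        ((\<lambda>\<phi>. {s \<in> topspace ?S. bal \<phi> s \<in> {c \<phi>}}) ` test_functions T E W)))"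
      by (intro closedin_Inter insert_not_empty)
    moreover have "\<Inter> (insert (topspace ?S)
        ((\<lambda>\<phi>. {s \<in> topspace ?S. bal \<phi> s \<in> {c \<phi>}}) ` test_functions T E W)) = R"
      unfolding R_eq by auto
    ultimately show ?thesis by simp
  qed
  moreover have "compact_space ?S"
    using E D by (simp add: compact_space_prod_topology compact_space_flow_top)
  ultimately have compact: "compact_space XR"
    unfolding XR_def by (intro compact_space_subtopology closedin_compact_space)
  \<comment> \<open>Stopping immediately: only the initial law is left to balance the constraint.\<close>
  have nonempty: "topspace XR \<noteq> {}"
  proof -
    define \<mu> where "\<mu> = (\<lambda>t\<in>{0..T}. \<lambda>u\<in>\<Omega> t. if t = 0 then initial_law M E X U u else null_measure (borel_on E))"
    define m where "m = (\<lambda>t\<in>{0..<T}. \<lambda>u\<in>\<Omega> t. null_measure (borel_on D))"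
    have pos: "hist_prob M U 0 u > 0" if "u \<in> \<Omega> 0" for u
      using that by (simp add: \<Omega>_def hist_supp_def)
    have X0: "X 0 \<in> F 0 \<rightarrow>\<^sub>M borel_on E" using X by simp
    note init = initial_law_integral[where X = X and U = U, OF space D(1,2) X0 A1 pos]
    have "(\<mu>, m) \<in> topspace ?S"
      using init(1) null_measure_in_subprobs[OF E(2)] null_measure_in_subprobs[OF D(3)]
      by (auto simp: topspace_flow_top \<mu>_def m_def)
    moreover have "bal \<phi> (\<mu>, m) = c \<phi>" if \<phi>: "\<phi> \<in> test_functions T E W" for \<phi>
    proof -
      have "flow_integral {0..T} \<Omega> p (\<lambda>t u x. \<phi> (t, x, u)) \<mu>
          = (\<Sum>t\<in>{0..T}. if t = 0 then c \<phi> else 0)"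
        unfolding flow_integral_def
      proof (intro sum.cong refl)
        fix t assume t: "t \<in> {0..T}"
        show "(\<Sum>u\<in>\<Omega> t. p t u * (\<integral>x. \<phi> (t, x, u) \<partial>\<mu> t u)) = (if t = 0 then c \<phi> else 0)"
        proof (cases "t = 0")
          case True
          have "(LINT x:D|initial_law M E X U u. \<phi> (0, x, u)) = (\<integral>x. \<phi> (0, x, u) \<partial>initial_law M E X U u)"
            if "u \<in> \<Omega> 0" for u
            using init(2)[OF that measurable_borel_on_continuous[OF test[OF \<phi>]], of 0 u] that by simp
          then show ?thesis using True by (simp add: c_def \<mu>_def)
        qed (use t in \<open>simp add: \<mu>_def\<close>)
      qed
      also have "\<dots> = c \<phi>" by simp
      finally show ?thesis by (simp add: bal_def flow_integral_def m_def)
    qed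
    ultimately show ?thesis by (auto simp: top_XR R_eq)
  qed
  have f_cont: "continuous_map (prod_topology (top_of_set D) (subprobs_top D)) euclideanreal
      (\<lambda>(x, \<nu>). f t (x, u, \<nu>))" if "t \<in> {0..<T}" "u \<in> \<Omega> t" for t u
    using that \<Omega>W by (intro continuous_map_fix_middle[OF A4_f]) auto
  have g_cont: "continuous_map (prod_topology (top_of_set E) (subprobs_top E)) euclideanreal
      (\<lambda>(x, \<nu>). g t (x, u, \<nu>))" if "t \<in> {0..T}" "u \<in> \<Omega> t" for t u
    using that \<Omega>W by (intro continuous_map_fix_middle[OF A4_g]) auto
  have cont: "continuous_map (prod_topology XR XR) euclideanreal (\<lambda>(s, s'). \<Gamma> s s')"
  proof -
    let ?Y = "prod_topology XR XR"
    have XS: "continuous_map XR ?S (\<lambda>s. s)" unfolding XR_def by (rule continuous_map_from_subtopology) simp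
    have proj: "continuous_map ?Y ?SE (\<lambda>y. fst (fst y))" "continuous_map ?Y ?SD (\<lambda>y. snd (fst y))"
      "continuous_map ?Y ?SE (\<lambda>y. fst (snd y))" "continuous_map ?Y ?SD (\<lambda>y. snd (snd y))"
      using continuous_map_compose[OF continuous_map_compose[OF continuous_map_fst[of XR XR] XS] continuous_map_fst]
        continuous_map_compose[OF continuous_map_compose[OF continuous_map_fst[of XR XR] XS] continuous_map_snd]
        continuous_map_compose[OF continuous_map_compose[OF continuous_map_snd[of XR XR] XS] continuous_map_fst]
        continuous_map_compose[OF continuous_map_compose[OF continuous_map_snd[of XR XR] XS] continuous_map_snd]
      by (simp_all add: comp_def)
    have fY: "continuous_map (prod_topology (top_of_set D) ?Y) euclideanreal
        (\<lambda>(x, y). f t (x, u, snd (fst y) t u))" if "t \<in> {0..<T}" "u \<in> \<Omega> t" for t u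
      by (rule continuous_map_second_compose[OF f_cont[OF that] continuous_map_flow_component[OF proj(2) that]])
    have gY: "continuous_map (prod_topology (top_of_set E) ?Y) euclideanreal
        (\<lambda>(x, y). g t (x, u, fst (fst y) t u))" if "t \<in> {0..T}" "u \<in> \<Omega> t" for t u
      by (rule continuous_map_second_compose[OF g_cont[OF that] continuous_map_flow_component[OF proj(1) that]])
    have "continuous_map ?Y euclideanreal
        (\<lambda>y. flow_integral {0..<T} \<Omega> p (\<lambda>t u x. f t (x, u, snd (fst y) t u)) (snd (snd y))
          + flow_integral {0..T} \<Omega> p (\<lambda>t u x. g t (x, u, fst (fst y) t u)) (fst (snd y)))"
      by (intro continuous_map_add continuous_map_flow_integral[OF D(2) _ fin\<Omega> proj(4)]
          continuous_map_flow_integral[OF E(1) _ fin\<Omega> proj(3)] fY gY) auto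
    then show ?thesis by (simp add: case_prod_unfold \<Gamma>_eq)
  qed
  have mix: "\<exists>k. continuous_map (top_of_set (prob_simplex n)) XR k \<and>
        (\<forall>s\<in>topspace XR. \<forall>\<theta>\<in>prob_simplex n. \<Gamma> s (k \<theta>) = (\<Sum>i<n. \<theta> i * \<Gamma> s (y i)))"
    if n: "n > 0" and y: "y \<in> {..<n} \<rightarrow> topspace XR" for n :: nat and y
  proof -
    have yE: "fst (y i) \<in> topspace ?SE" and yD: "snd (y i) \<in> topspace ?SD"
      and yR: "\<phi> \<in> test_functions T E W \<Longrightarrow> bal \<phi> (y i) = c \<phi>" if "i < n" for i \<phi>
    proof -
      have "y i \<in> R" using y that by (auto simp: top_XR)
      then show "fst (y i) \<in> topspace ?SE" "snd (y i) \<in> topspace ?SD"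
        "\<phi> \<in> test_functions T E W \<Longrightarrow> bal \<phi> (y i) = c \<phi>"
        by (auto simp: R_eq)
    qed
    define k where "k \<theta> = (mixture_flow {0..T} \<Omega> n \<theta> (\<lambda>i. fst (y i)),
      mixture_flow {0..<T} \<Omega> n \<theta> (\<lambda>i. snd (y i)))" for \<theta>
    have kS: "continuous_map (top_of_set (prob_simplex n)) ?S k"
      using continuous_map_mixture_flow[OF yE E(1)] continuous_map_mixture_flow[OF yD D(2)]
      by (simp add: continuous_map_pairwise comp_def k_def)
    have "bal \<phi> (k \<theta>) = c \<phi>" if \<theta>: "\<theta> \<in> prob_simplex n" and \<phi>: "\<phi> \<in> test_functions T E W" for \<theta> \<phi>
    proof -
      have "bal \<phi> (k \<theta>) = (\<Sum>i<n. \<theta> i * bal \<phi> (y i))"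
        unfolding bal_def k_def
        using flow_integral_mixture[where \<alpha> = "\<lambda>t u x. \<phi> (t, x, u)" and p = p, OF \<theta> yE E(1)]
          flow_integral_mixture[where \<alpha> = "\<lambda>t u x. generator \<pi> \<phi> (t, x, u)" and p = p, OF \<theta> yD D(2)]
          test[OF \<phi>] gen[OF \<phi>]
        by (simp add: case_prod_unfold right_diff_distrib sum_subtractf)
      also have "\<dots> = c \<phi>"
        using yR[OF _ \<phi>] \<theta> by (simp add: prob_simplex_def flip: sum_distrib_right)
      finally show ?thesis .
    qed
    then have "k \<theta> \<in> R" if "\<theta> \<in> prob_simplex n" for \<theta>
      using that continuous_map_image_subset_topspace[OF kS] by (auto simp: R_eq)
    then have "continuous_map (top_of_set (prob_simplex n)) XR k"
      unfolding XR_def using kS by (auto simp: continuous_map_in_subtopology)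
    moreover have "\<Gamma> s (k \<theta>) = (\<Sum>i<n. \<theta> i * \<Gamma> s (y i))" if s: "s \<in> R" and \<theta>: "\<theta> \<in> prob_simplex n" for s \<theta>
    proof -
      have s': "fst s \<in> topspace ?SE" "snd s \<in> topspace ?SD" using s by (auto simp: R_eq)
      have f': "continuous_on D (\<lambda>x. f t (x, u, snd s t u))" if "t \<in> {0..<T}" "u \<in> \<Omega> t" for t u
        using continuous_map_slice[OF f_cont[OF that], of "snd s t u"] flow_component_in[OF s'(2) that] by simp
      have g': "continuous_on E (\<lambda>x. g t (x, u, fst s t u))" if "t \<in> {0..T}" "u \<in> \<Omega> t" for t u
        using continuous_map_slice[OF g_cont[OF that], of "fst s t u"] flow_component_in[OF s'(1) that] by simp
      show ?thesis
        unfolding \<Gamma>_eq k_def fst_conv snd_conv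
        using flow_integral_mixture[where \<alpha> = "\<lambda>t u x. f t (x, u, snd s t u)" and p = p, OF \<theta> yD D(2) f']
          flow_integral_mixture[where \<alpha> = "\<lambda>t u x. g t (x, u, fst s t u)" and p = p, OF \<theta> yE E(1) g']
        by (simp add: distrib_left sum.distrib)
    qed
    ultimately show ?thesis using top_XR by blast
  qed
  from equilibrium_of_mixtures[OF compact nonempty cont mix]
  show ?thesis unfolding top_XR R_def \<Gamma>_def .
qed

end
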